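(* Let $(X^{(\varepsilon)})_{\varepsilon\ge0}$ be a regular perturbed Markov chain on a finite state space $S$ with transition matrices $P_\varepsilon$, let $E_1,\dots,E_n$ be its $P_0$-essential classes, pick $x_i\in E_i$ for each $i$, and set $S_0=\{x_1,\dots,x_n\}$. Define, for $\varepsilon>0$, the matrix $\hat P_\varepsilon$ on $S_0$ by $$\hat p_\varepsilon(x_i,x_j)=\nu_{E_i}(x_i)\,\mathbb P_\varepsilon^{x_i}(X_{\tau_{S_0}^+}=x_j)\ (i\ne j),\qquad \hat p_\varepsilon(x_i,x_i)=\nu_{E_i}(x_i)\,\mathbb P_\varepsilon^{x_i}(X_{\tau_{S_0}^+}=x_i)+1-\nu_{E_i}(x_i),$$ and the matrix $\check P_\varepsilon$ on $S_0$ by $$\check p_\varepsilon(x_i,x_j)=\frac{\hat p_\varepsilon(x_i,x_j)}{\sum_{k,l:\,k\ne l}\hat p_\varepsilon(x_k,x_l)}\ (i\neq j),\qquad \check p_\varepsilon(x_i,x_i)=1-\sum_{j:\,j\ne i}\check p_\varepsilon(x_i,x_j).$$ Then $\hat P_\varepsilon$ and $\check P_\varepsilon$ are transition matrices of regular perturbed Markov chains.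
   Context: Let $S$ be a finite set. For $\varepsilon\ge 0$ let $X^{(\varepsilon)}$ be a discrete time Markov chain on $S$ with transition matrix $P_\varepsilon=(p_\varepsilon(x,y))_{x,y\in S}$; $\mathbb P_\varepsilon^x$ is its path measure when started in $x$. The family is a perturbed Markov chain if $\lim_{\varepsilon\to0}p_\varepsilon(x,y)=p_0(x,y)$ for all $x,y\in S$, and an irreducibly perturbed Markov chain if in addition $X^{(\varepsilon)}$ is irreducible for every $\varepsilon>0$. For a family of transition matrices given for $\varepsilon>0$, being (the transition matrices of) a perturbed Markov chain means that the limits of all entries as $\varepsilon\to0$ exist; these limits then define the matrix at $\varepsilon=0$. Two functions $a_\varepsilon,b_\varepsilon$ of $\varepsilon>0$ are asymptotically comparable, $a_\varepsilon\sim b_\varepsilon$, if either both are strictly positive and $\lim_{\varepsilon\to0}a_\varepsilon/b_\varepsilon$ exists in $[0,\infty]$, or one or both of them are identically zero. An irreducibly perturbed Markov chain $X^{(\varepsilon)}$ is regular if for all $m,n\in\mathbb N$ and all finite sequences of pairs $(x_i,y_i)_{i\le n}$, $(z_i,w_i)_{i\le m}$ of elements of its state space, $$\prod_{i=1}^n p_\varepsilon(x_i,y_i)\sim\prod_{i=1}^m p_\varepsilon(z_i,w_i).$$ The $P_0$-essential classes are the essential (closed) communicating classes of the chain with transition matrix $P_0$. For a $P_0$-essential class $E$, $\nu_E$ is the unique stationary distribution of the irreducible chain on $E$ with transition matrix $(p_0(x,y))_{x,y\in E}$. For $A\subset S$, $\tau_A^+=\inf\{n>0:X_n\in A\}$.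 *)

theory Defs
  imports "HOL-Probability.Probability"
begin

subsection \<open>Transition matrices on a finite set\<close>

definition stochastic :: "'a set \<Rightarrow> ('a \<Rightarrow> 'a \<Rightarrow> real) \<Rightarrow> bool" where
  "stochastic S p \<longleftrightarrow> (\<forall>x\<in>S. (\<forall>y\<in>S. 0 \<le> p x y) \<and> (\<Sum>y\<in>S. p x y) = 1)"

definition step_rel :: "'a set \<Rightarrow> ('a \<Rightarrow> 'a \<Rightarrow> real) \<Rightarrow> ('a \<times> 'a) set" where
  "step_rel S p = {(x, y). x \<in> S \<and> y \<in> S \<and> 0 < p x y}"

definition irreducible_chain :: "'a set \<Rightarrow> ('a \<Rightarrow> 'a \<Rightarrow> real) \<Rightarrow> bool" where
  "irreducible_chain S p \<longleftrightarrow> (\<forall>x\<in>S. \<forall>y\<in>S. (x, y) \<in> (step_rel S p)\<^sup>*)"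

definition communicates :: "'a set \<Rightarrow> ('a \<Rightarrow> 'a \<Rightarrow> real) \<Rightarrow> ('a \<times> 'a) set" where
  "communicates S p =
    {(x, y). x \<in> S \<and> y \<in> S \<and> (x, y) \<in> (step_rel S p)\<^sup>* \<and> (y, x) \<in> (step_rel S p)\<^sup>*}"

definition essential_classes :: "'a set \<Rightarrow> ('a \<Rightarrow> 'a \<Rightarrow> real) \<Rightarrow> 'a set set" where
  "essential_classes S p = {E \<in> S // communicates S p. step_rel S p `` E \<subseteq> E}"

definition stationary_distribution :: "'a set \<Rightarrow> ('a \<Rightarrow> 'a \<Rightarrow> real) \<Rightarrow> ('a \<Rightarrow> real) \<Rightarrow> bool" where
  "stationary_distribution E p \<nu> \<longleftrightarrow>
    (\<forall>x\<in>E. 0 \<le> \<nu> x) \<and> (\<Sum>x\<in>E. \<nu> x) = 1 \<and> (\<forall>y\<in>E. (\<Sum>x\<in>E. \<nu> x * p x y) = \<nu> y)"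

subsection \<open>Perturbed Markov chains\<close>

definition perturbed_chain :: "'a set \<Rightarrow> (real \<Rightarrow> 'a \<Rightarrow> 'a \<Rightarrow> real) \<Rightarrow> bool" where
  "perturbed_chain S P \<longleftrightarrow>
    (\<forall>\<epsilon>\<ge>0. stochastic S (P \<epsilon>)) \<and>
    (\<forall>x\<in>S. \<forall>y\<in>S. ((\<lambda>\<epsilon>. P \<epsilon> x y) \<longlongrightarrow> P 0 x y) (at_right 0))"

definition irreducibly_perturbed_chain :: "'a set \<Rightarrow> (real \<Rightarrow> 'a \<Rightarrow> 'a \<Rightarrow> real) \<Rightarrow> bool" where
  "irreducibly_perturbed_chain S P \<longleftrightarrow>
    perturbed_chain S P \<and> (\<forall>\<epsilon>>0. irreducible_chain S (P \<epsilon>))"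

definition asymp_comparable :: "(real \<Rightarrow> real) \<Rightarrow> (real \<Rightarrow> real) \<Rightarrow> bool" where
  "asymp_comparable a b \<longleftrightarrow>
    (\<forall>\<epsilon>>0. 0 < a \<epsilon> \<and> 0 < b \<epsilon>) \<and>
      (\<exists>L::ereal. 0 \<le> L \<and> ((\<lambda>\<epsilon>. ereal (a \<epsilon> / b \<epsilon>)) \<longlongrightarrow> L) (at_right 0)) \<or>
    (\<forall>\<epsilon>>0. a \<epsilon> = 0) \<or> (\<forall>\<epsilon>>0. b \<epsilon> = 0)"

text \<open>The finite sequences of pairs are lists. The empty list is admitted; this changes nothing,
  because comparability of a product with the constant 1 already follows from convergence of the
  entries and from comparability of the product with itself.\<close>

definition regular_perturbed_chain :: "'a set \<Rightarrow> (real \<Rightarrow> 'a \<Rightarrow> 'a \<Rightarrow> real) \<Rightarrow> bool" where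
  "regular_perturbed_chain S P \<longleftrightarrow>
    irreducibly_perturbed_chain S P \<and>
    (\<forall>as bs. set as \<subseteq> S \<times> S \<longrightarrow> set bs \<subseteq> S \<times> S \<longrightarrow>
      asymp_comparable (\<lambda>\<epsilon>. \<Prod>(x, y)\<leftarrow>as. P \<epsilon> x y) (\<lambda>\<epsilon>. \<Prod>(x, y)\<leftarrow>bs. P \<epsilon> x y))"

text \<open>A family given only for positive \<open>\<epsilon>\<close>: the value of the given function at \<open>0\<close> is
  irrelevant and is replaced by the entrywise limit.\<close>

definition regular_perturbed_family :: "'a set \<Rightarrow> (real \<Rightarrow> 'a \<Rightarrow> 'a \<Rightarrow> real) \<Rightarrow> bool" where
  "regular_perturbed_family S Q \<longleftrightarrow> (\<exists>Q0. regular_perturbed_chain S (Q(0 := Q0)))"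

subsection \<open>Path measure and return times\<close>

definition is_path_measure ::
    "'a set \<Rightarrow> ('a \<Rightarrow> 'a \<Rightarrow> real) \<Rightarrow> 'a \<Rightarrow> (nat \<Rightarrow> 'a) measure \<Rightarrow> bool" where
  "is_path_measure S p x M \<longleftrightarrow>
    prob_space M \<and>
    sets M = sets (\<Pi>\<^sub>M i\<in>(UNIV :: nat set). count_space S) \<and>
    (\<forall>n y. (\<forall>i\<le>n. y i \<in> S) \<longrightarrow>
      measure M {\<omega> \<in> space M. \<forall>i\<le>n. \<omega> i = y i} =
        (if y 0 = x then \<Prod>i<n. p (y i) (y (Suc i)) else 0))"

definition path_measure :: "'a set \<Rightarrow> ('a \<Rightarrow> 'a \<Rightarrow> real) \<Rightarrow> 'a \<Rightarrow> (nat \<Rightarrow> 'a) measure" where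
  "path_measure S p x = (THE M. is_path_measure S p x M)"

definition return_time :: "'a set \<Rightarrow> (nat \<Rightarrow> 'a) \<Rightarrow> enat" where
  "return_time A \<omega> = Inf {enat n | n. 0 < n \<and> \<omega> n \<in> A}"

text \<open>Probability that the chain started in \<open>x\<close> returns to \<open>A\<close> in finite time and is then in \<open>y\<close>.\<close>

definition return_prob :: "'a set \<Rightarrow> ('a \<Rightarrow> 'a \<Rightarrow> real) \<Rightarrow> 'a \<Rightarrow> 'a set \<Rightarrow> 'a \<Rightarrow> real" where
  "return_prob S p x A y =
    measure (path_measure S p x)
      {\<omega> \<in> space (path_measure S p x). \<exists>n. return_time A \<omega> = enat n \<and> \<omega> n = y}"

subsection \<open>Existence and uniqueness of the path measure\<close>

lemma is_path_measure_unique: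
  assumes S: "finite S" and M: "is_path_measure S p x M" and N: "is_path_measure S p x N"
  shows "M = N"
proof -
  interpret M: prob_space M using M by (simp add: is_path_measure_def)
  interpret N: prob_space N using N by (simp add: is_path_measure_def)
  let ?P = "\<Pi>\<^sub>M i\<in>(UNIV :: nat set). count_space S"
  have sM: "sets M = sets ?P" and sN: "sets N = sets ?P"
    using M N by (simp_all add: is_path_measure_def)
  have spM: "space M = space ?P" and spN: "space N = space ?P"
    using sM sN by (auto dest: sets_eq_imp_space_eq)
  have sp: "space ?P = UNIV \<rightarrow> S" by (auto simp: space_PiM PiE_def)
  show ?thesis
  proof (rule measure_eqI_PiM_infinite[OF sM sN])
    fix A :: "nat \<Rightarrow> 'a set" and J :: "nat set"
    assume J: "finite J" and A: "\<And>i. i \<in> J \<Longrightarrow> A i \<in> sets (count_space S)"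
    obtain n where n: "J \<subseteq> {..n}" using J by (meson finite_nat_iff_bounded_le)
    define B where "B = (\<lambda>i. if i \<in> J then A i else S)"
    have BS: "B i \<subseteq> S" for i using A by (auto simp: B_def)
    define Y where "Y = PiE {..n} B"
    have finY: "finite Y"
      unfolding Y_def using BS S by (intro finite_PiE) (auto intro: finite_subset)
    define cyl where "cyl y = {\<omega> \<in> space ?P. \<forall>i\<le>n. \<omega> i = y i}" for y :: "nat \<Rightarrow> 'a"
    have cyl_sets: "cyl y \<in> sets ?P" if "y \<in> Y" for y
    proof -
      have "cyl y = prod_emb UNIV (\<lambda>_. count_space S) {..n} (PiE {..n} (\<lambda>i. {y i}))"
        by (auto simp: cyl_def prod_emb_def space_PiM PiE_iff restrict_def extensional_def)
      moreover have "y i \<in> S" if "i \<le> n" for i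
        using \<open>y \<in> Y\<close> that BS by (auto simp: Y_def PiE_iff)
      ultimately show ?thesis by (auto intro!: sets_PiM_I)
    qed
    have eq: "prod_emb UNIV (\<lambda>_. count_space S) J (PiE J A) = (\<Union>y\<in>Y. cyl y)"
    proof safe
      fix \<omega> assume w: "\<omega> \<in> prod_emb UNIV (\<lambda>_. count_space S) J (PiE J A)"
      then have "restrict \<omega> {..n} \<in> Y"
        by (auto simp: Y_def B_def prod_emb_def PiE_iff space_PiM)
      moreover have "\<omega> \<in> cyl (restrict \<omega> {..n})"
        using w by (auto simp: cyl_def prod_emb_def space_PiM)
      ultimately show "\<omega> \<in> (\<Union>y\<in>Y. cyl y)" by blast
    next
      fix \<omega> y assume y: "y \<in> Y" and w: "\<omega> \<in> cyl y"
      have "\<omega> i \<in> A i" if "i \<in> J" for i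
      proof -
        have "\<omega> i = y i" using w that n by (auto simp: cyl_def)
        moreover have "y i \<in> B i" using y that n by (auto simp: Y_def PiE_iff)
        ultimately show ?thesis using that by (simp add: B_def)
      qed
      then show "\<omega> \<in> prod_emb UNIV (\<lambda>_. count_space S) J (PiE J A)"
        using w by (auto simp: cyl_def prod_emb_def space_PiM PiE_iff)
    qed
    have disj: "disjoint_family_on cyl Y"
      unfolding disjoint_family_on_def
    proof (intro ballI impI)
      fix y z assume y: "y \<in> Y" and z: "z \<in> Y" and ne: "y \<noteq> z"
      then obtain i where "i \<le> n" "y i \<noteq> z i"
        unfolding Y_def by (metis PiE_ext atMost_iff)
      then show "cyl y \<inter> cyl z = {}" by (auto simp: cyl_def)
    qed
    have same: "measure M (cyl y) = measure N (cyl y)" if "y \<in> Y" for y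
    proof -
      have "\<forall>i\<le>n. y i \<in> S" using that BS by (auto simp: Y_def PiE_iff)
      then show ?thesis
        using M N unfolding is_path_measure_def cyl_def spM[symmetric]
        by (simp add: spM spN)
    qed
    have "measure M (\<Union>y\<in>Y. cyl y) = (\<Sum>y\<in>Y. measure M (cyl y))"
      using finY disj cyl_sets sM by (intro M.finite_measure_finite_Union) auto
    also have "\<dots> = (\<Sum>y\<in>Y. measure N (cyl y))" using same by (intro sum.cong) auto
    also have "\<dots> = measure N (\<Union>y\<in>Y. cyl y)"
      using finY disj cyl_sets sN by (intro N.finite_measure_finite_Union[symmetric]) auto
    finally show "emeasure M (prod_emb UNIV (\<lambda>_. count_space S) J (PiE J A)) =
        emeasure N (prod_emb UNIV (\<lambda>_. count_space S) J (PiE J A))"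
      by (simp add: eq M.emeasure_eq_measure N.emeasure_eq_measure)
  qed (rule M.finite_measure_axioms)
qed

lemma is_path_measure_exists:
  assumes S: "finite S" and p: "stochastic S p" and x: "x \<in> S"
  shows "\<exists>M. is_path_measure S p x M"
proof -
  define K :: "nat \<Rightarrow> (nat \<Rightarrow> 'a) \<Rightarrow> 'a measure" where
    "K n \<omega> = (case n of 0 \<Rightarrow> return (count_space S) x
                 | Suc m \<Rightarrow> point_measure S (\<lambda>z. ennreal (p (\<omega> m) z)))" for n \<omega>
  let ?M = "\<lambda>_::nat. count_space S"
  have prob: "prob_space (point_measure S (\<lambda>z. ennreal (p u z)))" if "u \<in> S" for u
  proof (rule prob_spaceI)
    have "(\<Sum>z\<in>S. ennreal (p u z)) = ennreal (\<Sum>z\<in>S. p u z)"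
      using p that by (intro sum_ennreal) (auto simp: stochastic_def)
    then show "emeasure (point_measure S (\<lambda>z. ennreal (p u z)))
        (space (point_measure S (\<lambda>z. ennreal (p u z)))) = 1"
      using p that S by (simp add: space_point_measure emeasure_point_measure_finite stochastic_def)
  qed
  interpret IT: Ionescu_Tulcea K ?M
  proof (rule Ionescu_Tulcea.intro)
    fix n
    show "K n \<in> PiM {0..<n} ?M \<rightarrow>\<^sub>M subprob_algebra (count_space S)"
    proof (cases n)
      case 0
      then show ?thesis using x
        by (auto simp: K_def[abs_def] space_subprob_algebra prob_space_imp_subprob_space
            prob_space_return intro!: measurable_const)
    next
      case (Suc m)
      have "(\<lambda>u. point_measure S (\<lambda>z. ennreal (p u z))) \<in>
          count_space S \<rightarrow>\<^sub>M subprob_algebra (count_space S)"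
        by (auto simp: space_subprob_algebra sets_point_measure
            intro!: prob_space_imp_subprob_space prob)
      moreover have "(\<lambda>\<omega>. \<omega> m) \<in> PiM {0..<n} ?M \<rightarrow>\<^sub>M count_space S"
        by (rule measurable_component_singleton) (simp add: Suc)
      ultimately have "(\<lambda>\<omega>. point_measure S (\<lambda>z. ennreal (p (\<omega> m) z))) \<in>
          PiM {0..<n} ?M \<rightarrow>\<^sub>M subprob_algebra (count_space S)"
        by (rule measurable_compose[rotated])
      then show ?thesis by (simp add: K_def[abs_def] Suc)
    qed
  next
    fix n :: nat and \<omega> :: "nat \<Rightarrow> 'a" assume "\<omega> \<in> space (PiM {0..<n} ?M)"
    then show "prob_space (K n \<omega>)"
      using x by (cases n) (auto simp: K_def space_PiM PiE_iff intro!: prob prob_space_return)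
  qed
  let ?u = "\<lambda>_::nat. undefined :: 'a"
  have u: "?u \<in> space (PiM {0..<0} ?M)" by (simp add: space_PiM)
  have sing: "{w} \<in> sets (PiM {0..<n} ?M)" if "w \<in> PiE {0..<n} (\<lambda>_. S)" for w n
  proof -
    have "{w} = PiE {0..<n} (\<lambda>i. {w i})"
      using that PiE_singleton[of w "{0..<n}"] by (simp add: PiE_iff)
    also have "\<dots> \<in> sets (PiM {0..<n} ?M)"
      using that by (intro sets_PiM_I_finite) (auto simp: PiE_iff)
    finally show ?thesis .
  qed
  have C: "emeasure (IT.C 0 (Suc n) ?u) {w} =
      ennreal (if w 0 = x then \<Prod>i<n. p (w i) (w (Suc i)) else 0)"
    if "w \<in> PiE {0..<Suc n} (\<lambda>_. S)" for w n
    using that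
  proof (induction n arbitrary: w)
    case 0
    have "IT.C 0 (Suc 0) ?u = IT.eP 0 ?u"
      using bind_return[OF IT.measurable_eP u] by simp
    then have "emeasure (IT.C 0 (Suc 0) ?u) {w} =
        K 0 ?u ((\<lambda>z. fun_upd ?u 0 z) -` {w} \<inter> space (count_space S))"
      using IT.emeasure_eP[OF u sing[OF 0]] by simp
    also have "(\<lambda>z. fun_upd ?u 0 z) -` {w} \<inter> space (count_space S) = {w 0}"
    proof -
      have "w i = undefined" if "i \<noteq> 0" for i
        using 0 that by (intro PiE_arb[of w "{0..<Suc 0}" "\<lambda>_. S"]) auto
      then have upd: "fun_upd ?u 0 (w 0) = w" by (intro ext) (simp add: fun_upd_apply)
      have wS: "w 0 \<in> S" using 0 by (auto simp: PiE_iff)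
      have "z = w 0" if "fun_upd ?u 0 z = w" for z
        using fun_cong[OF that, of 0] by simp
      then show ?thesis using upd wS unfolding space_count_space by blast
    qed
    also have "K 0 ?u {w 0} = indicator {w 0} x"
      using 0 by (auto simp: K_def PiE_iff)
    finally show ?case by (auto simp: indicator_def)
  next
    case (Suc n)
    let ?w = "restrict w {0..<Suc n}"
    have w': "?w \<in> PiE {0..<Suc n} (\<lambda>_. S)" using Suc.prems by (auto simp: PiE_iff)
    have wS: "w i \<in> S" if "i < Suc (Suc n)" for i using Suc.prems that by (auto simp: PiE_iff)
    have eP: "emeasure (IT.eP (Suc n) \<omega>) {w} = ennreal (p (w n) (w (Suc n))) * indicator {?w} \<omega>"
      if \<omega>: "\<omega> \<in> space (PiM {0..<Suc n} ?M)" for \<omega>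
    proof -
      have eq: "emeasure (IT.eP (Suc n) \<omega>) {w} =
          K (Suc n) \<omega> ((\<lambda>z. fun_upd \<omega> (Suc n) z) -` {w} \<inter> space (count_space S))"
        by (rule IT.emeasure_eP[OF \<omega> sing[OF Suc.prems]])
      have ext: "\<omega> \<in> extensional {0..<Suc n}" "w \<in> extensional {0..<Suc (Suc n)}"
        using \<omega> Suc.prems by (auto simp: space_PiM PiE_iff)
      show ?thesis
      proof (cases "\<omega> = ?w")
        case True
        have upd: "fun_upd \<omega> (Suc n) (w (Suc n)) = w"
          using ext by (auto simp: True fun_eq_iff restrict_def extensional_def)
        have "z = w (Suc n)" if "fun_upd \<omega> (Suc n) z = w" for z
          using fun_cong[OF that, of "Suc n"] by simp
        then have "(\<lambda>z. fun_upd \<omega> (Suc n) z) -` {w} \<inter> space (count_space S) = {w (Suc n)}"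
          using wS[of "Suc n", OF lessI] upd unfolding space_count_space by blast
        then have "emeasure (IT.eP (Suc n) \<omega>) {w} = K (Suc n) \<omega> {w (Suc n)}"
          unfolding eq by simp
        also have "\<dots> = ennreal (p (\<omega> n) (w (Suc n)))"
          using wS[of "Suc n"] S by (simp add: K_def emeasure_point_measure_finite)
        also have "\<omega> n = w n" using True by simp
        finally have "emeasure (IT.eP (Suc n) \<omega>) {w} = ennreal (p (w n) (w (Suc n)))" .
        moreover have "indicator {?w} \<omega> = (1 :: ennreal)"
          unfolding True[symmetric] by simp
        ultimately show ?thesis by (simp only: mult_1_right)
      next
        case False
        have "fun_upd \<omega> (Suc n) z \<noteq> w" for z
        proof
          assume "fun_upd \<omega> (Suc n) z = w"
          then have w: "w = fun_upd \<omega> (Suc n) z" by (rule sym)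
          have "\<omega> = ?w"
            using ext(1) unfolding w by (intro HOL.ext) (simp add: restrict_def extensional_def)
          with False show False ..
        qed
        then have "(\<lambda>z. fun_upd \<omega> (Suc n) z) -` {w} \<inter> space (count_space S) = {}" by auto
        then show ?thesis using False by (simp add: eq)
      qed
    qed
    have spC: "space (IT.C 0 (Suc n) ?u) = space (PiM {0..<Suc n} ?M)"
      using IT.space_C[OF u, of "Suc n"] by simp
    have setC: "sets (IT.C 0 (Suc n) ?u) = sets (PiM {0..<Suc n} ?M)"
      using IT.sets_C[OF u, of "Suc n"] by simp
    have "emeasure (IT.C 0 (Suc (Suc n)) ?u) {w} =
        emeasure (IT.C 0 (Suc n) ?u \<bind> IT.eP (Suc n)) {w}" by simp
    also have "\<dots> = (\<integral>\<^sup>+\<omega>. emeasure (IT.eP (Suc n) \<omega>) {w} \<partial>IT.C 0 (Suc n) ?u)"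
    proof (rule emeasure_bind)
      show "space (IT.C 0 (Suc n) ?u) \<noteq> {}"
        unfolding spC space_PiM space_count_space using w' by blast
      show "IT.eP (Suc n) \<in> IT.C 0 (Suc n) ?u \<rightarrow>\<^sub>M subprob_algebra (PiM {0..<Suc (Suc n)} ?M)"
        unfolding measurable_cong_sets[OF setC refl] by (rule IT.measurable_eP)
      show "{w} \<in> sets (PiM {0..<Suc (Suc n)} ?M)" by (rule sing[OF Suc.prems])
    qed
    also have "\<dots> = (\<integral>\<^sup>+\<omega>. ennreal (p (w n) (w (Suc n))) * indicator {?w} \<omega> \<partial>IT.C 0 (Suc n) ?u)"
      by (intro nn_integral_cong eP) (simp only: spC)
    also have "\<dots> = ennreal (p (w n) (w (Suc n))) * emeasure (IT.C 0 (Suc n) ?u) {?w}"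
      by (rule nn_integral_cmult_indicator) (simp only: setC sing[OF w'])
    also have "\<dots> = ennreal (p (w n) (w (Suc n))) *
        ennreal (if ?w 0 = x then \<Prod>i<n. p (?w i) (?w (Suc i)) else 0)"
      by (simp only: Suc.IH[OF w'])
    also have "(if ?w 0 = x then \<Prod>i<n. p (?w i) (?w (Suc i)) else 0) =
        (if w 0 = x then \<Prod>i<n. p (w i) (w (Suc i)) else 0)"
      by (auto intro!: prod.cong)
    also have "ennreal (p (w n) (w (Suc n))) * ennreal \<dots> =
        ennreal (if w 0 = x then \<Prod>i<Suc n. p (w i) (w (Suc i)) else 0)"
      using p wS by (auto simp: ennreal_mult'[symmetric] stochastic_def mult.commute)
    finally show ?case .
  qed
  let ?L = "IT.PF.lim"
  have spL: "space ?L = space (PiM UNIV ?M)" by (rule sets_eq_imp_space_eq) simp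
  have "prob_space (IT.CI {0..<1})"
    by (rule IT.PF.prob_space_P) auto
  have emb_sp: "IT.PF.emb UNIV {0..<1} (space (PiM {0..<1} ?M)) = space ?L"
    by (auto simp: spL prod_emb_def space_PiM PiE_iff)
  have "prob_space ?L"
  proof (rule prob_spaceI)
    have "emeasure ?L (space ?L) = emeasure (IT.CI {0..<1}) (space (PiM {0..<1} ?M))"
      using IT.lim[of "{0..<1}" "space (PiM {0..<1} ?M)"] unfolding emb_sp by simp
    also have "\<dots> = 1"
      using prob_space.emeasure_space_1[OF \<open>prob_space (IT.CI {0..<1})\<close>] by (simp add: IT.CI_def)
    finally show "emeasure ?L (space ?L) = 1" .
  qed
  moreover have "sets ?L = sets (PiM UNIV ?M)" by simp
  moreover have "measure ?L {\<omega> \<in> space ?L. \<forall>i\<le>n. \<omega> i = y i} =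
      (if y 0 = x then \<Prod>i<n. p (y i) (y (Suc i)) else 0)" if y: "\<forall>i\<le>n. y i \<in> S" for n y
  proof -
    let ?y = "restrict y {0..<Suc n}"
    have y': "?y \<in> PiE {0..<Suc n} (\<lambda>_. S)" using y by (auto simp: PiE_iff)
    have "{\<omega> \<in> space ?L. \<forall>i\<le>n. \<omega> i = y i} = IT.PF.emb UNIV {0..<Suc n} {?y}"
    proof -
      have "(\<forall>i\<le>n. \<omega> i = y i) \<longleftrightarrow> restrict \<omega> {0..<Suc n} = ?y" for \<omega>
        by (metis atLeastLessThan_iff le0 less_Suc_eq_le restrict_apply' restrict_ext)
      then show ?thesis by (auto simp: spL prod_emb_def space_PiM)
    qed
    then have "emeasure ?L {\<omega> \<in> space ?L. \<forall>i\<le>n. \<omega> i = y i} = emeasure (IT.CI {0..<Suc n}) {?y}"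
      using IT.lim[OF _ sing[OF y']] by simp
    also have "\<dots> = emeasure (IT.C 0 (Suc n) ?u) (IT.PF.emb {0..<Suc n} {0..<Suc n} {?y})"
      by (rule IT.emeasure_CI[OF _ sing[OF y']]) simp
    also have "IT.PF.emb {0..<Suc n} {0..<Suc n} {?y} = {?y}"
      by (rule prod_emb_id) (use y' in simp)
    also have "emeasure (IT.C 0 (Suc n) ?u) {?y} =
        ennreal (if ?y 0 = x then \<Prod>i<n. p (?y i) (?y (Suc i)) else 0)" by (rule C[OF y'])
    also have "(if ?y 0 = x then \<Prod>i<n. p (?y i) (?y (Suc i)) else 0) =
        (if y 0 = x then \<Prod>i<n. p (y i) (y (Suc i)) else 0)"
      by (auto intro!: prod.cong)
    finally have "emeasure ?L {\<omega> \<in> space ?L. \<forall>i\<le>n. \<omega> i = y i} =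
      ennreal (if y 0 = x then \<Prod>i<n. p (y i) (y (Suc i)) else 0)" .
    moreover have "0 \<le> (if y 0 = x then \<Prod>i<n. p (y i) (y (Suc i)) else 0)"
      using p y by (auto simp: stochastic_def intro!: prod_nonneg)
    ultimately show ?thesis by (simp add: measure_def)
  qed
  ultimately show ?thesis unfolding is_path_measure_def by blast
qed

lemma is_path_measure_path_measure:
  assumes "finite S" "stochastic S p" "x \<in> S"
  shows "is_path_measure S p x (path_measure S p x)"
  unfolding path_measure_def
  using is_path_measure_exists[OF assms] is_path_measure_unique[OF assms(1)]
  by (metis (no_types, lifting) theI)

end

theory Submission
  imports Defs
begin

text \<open>
  Call a function of \<open>\<epsilon>\<close> tame if it vanishes identically or is positive and asymptotic, up to a
  positive constant, to a quotient of monomials in the entries of \<open>P \<epsilon>\<close>. Regularity makes any two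
  tame functions comparable, so that tame functions are closed under sums, products and quotients.
  The return probabilities to \<open>S0\<close> arise by eliminating the states outside \<open>S0\<close> one after the
  other. Writing \<open>1 - q u u\<close> as the sum of the other entries of the row, each elimination step
  involves no subtraction and hence preserves tameness, besides stochasticity and irreducibility.
  Thus the return probabilities are tame, and so are the entries of both matrices.
\<close>

section \<open>Comparability of functions with a monomial leading term\<close>

locale regular_chain =
  fixes S :: "'a set" and P :: "real \<Rightarrow> 'a \<Rightarrow> 'a \<Rightarrow> real"
  assumes regular: "regular_perturbed_chain S P"
begin

definition monomial :: "('a \<times> 'a) list \<Rightarrow> real \<Rightarrow> real" where
  "monomial as \<epsilon> = (\<Prod>(x, y)\<leftarrow>as. P \<epsilon> x y)"

definition pos_monomial :: "('a \<times> 'a) list \<Rightarrow> bool" where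
  "pos_monomial as \<longleftrightarrow> set as \<subseteq> S \<times> S \<and> (\<forall>\<epsilon>>0. 0 < monomial as \<epsilon>)"

text \<open>Quotients of monomials, not just monomials, serve as leading terms so that inverses stay
  in the class. Positivity is required for every positive \<open>\<epsilon>\<close> and not only
  near 0, since \<open>asymp_comparable\<close> requires it there.\<close>

definition pos_tame :: "(real \<Rightarrow> real) \<Rightarrow> bool" where
  "pos_tame f \<longleftrightarrow> (\<forall>\<epsilon>>0. 0 < f \<epsilon>) \<and> (\<exists>as bs c. pos_monomial as \<and> pos_monomial bs \<and> 0 < c \<and>
    ((\<lambda>\<epsilon>. f \<epsilon> * monomial bs \<epsilon> / monomial as \<epsilon>) \<longlongrightarrow> c) (at_right 0))"

definition tame :: "(real \<Rightarrow> real) \<Rightarrow> bool" where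
  "tame f \<longleftrightarrow> (\<forall>\<epsilon>>0. f \<epsilon> = 0) \<or> pos_tame f"

lemma monomial_append: "monomial (as @ bs) \<epsilon> = monomial as \<epsilon> * monomial bs \<epsilon>"
  by (simp add: monomial_def)

lemma pos_monomial_Nil: "pos_monomial []"
  by (simp add: pos_monomial_def monomial_def)

lemma pos_monomial_append: "pos_monomial as \<Longrightarrow> pos_monomial bs \<Longrightarrow> pos_monomial (as @ bs)"
  by (simp add: pos_monomial_def monomial_append)

lemma pos_monomial_pos: "pos_monomial as \<Longrightarrow> 0 < \<epsilon> \<Longrightarrow> 0 < monomial as \<epsilon>"
  by (simp add: pos_monomial_def)

lemma pos_tame_pos: "pos_tame f \<Longrightarrow> 0 < \<epsilon> \<Longrightarrow> 0 < f \<epsilon>"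
  by (simp add: pos_tame_def)

lemma eventually_at_right_0_pos: "eventually (\<lambda>\<epsilon>::real. 0 < \<epsilon>) (at_right 0)"
  by (simp add: eventually_at_right_less)

lemma pos_tameI:
  assumes "\<And>\<epsilon>. 0 < \<epsilon> \<Longrightarrow> 0 < f \<epsilon>" "pos_monomial as" "pos_monomial bs" "0 < c"
    "((\<lambda>\<epsilon>. f \<epsilon> * monomial bs \<epsilon> / monomial as \<epsilon>) \<longlongrightarrow> c) (at_right 0)"
  shows "pos_tame f"
  using assms unfolding pos_tame_def by blast

lemma pos_tameE:
  assumes "pos_tame f"
  obtains as bs c where "pos_monomial as" "pos_monomial bs" "0 < c"
    "((\<lambda>\<epsilon>. f \<epsilon> * monomial bs \<epsilon> / monomial as \<epsilon>) \<longlongrightarrow> c) (at_right 0)"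
  using assms unfolding pos_tame_def by blast

lemma pos_tame_cong:
  assumes "pos_tame f" "\<And>\<epsilon>. 0 < \<epsilon> \<Longrightarrow> g \<epsilon> = f \<epsilon>"
  shows "pos_tame g"
proof -
  obtain as bs c where m: "pos_monomial as" "pos_monomial bs" "0 < c"
    and lim: "((\<lambda>\<epsilon>. f \<epsilon> * monomial bs \<epsilon> / monomial as \<epsilon>) \<longlongrightarrow> c) (at_right 0)"
    using assms(1) by (rule pos_tameE)
  show ?thesis
  proof (rule pos_tameI[OF _ m])
    show "((\<lambda>\<epsilon>. g \<epsilon> * monomial bs \<epsilon> / monomial as \<epsilon>) \<longlongrightarrow> c) (at_right 0)"
      by (rule Lim_transform_eventually[OF lim])
        (use eventually_at_right_0_pos assms(2) in \<open>auto elim!: eventually_mono\<close>)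
  qed (use assms in \<open>simp add: pos_tame_pos\<close>)
qed

lemma tame_cong:
  assumes "tame f" "\<And>\<epsilon>. 0 < \<epsilon> \<Longrightarrow> g \<epsilon> = f \<epsilon>"
  shows "tame g"
  using assms pos_tame_cong[of f g] unfolding tame_def by auto

section \<open>Products, inverses and constants\<close>

lemma pos_tame_mult:
  assumes "pos_tame f" "pos_tame g"
  shows "pos_tame (\<lambda>\<epsilon>. f \<epsilon> * g \<epsilon>)"
proof -
  obtain as bs c where f: "pos_monomial as" "pos_monomial bs" "0 < c"
    "((\<lambda>\<epsilon>. f \<epsilon> * monomial bs \<epsilon> / monomial as \<epsilon>) \<longlongrightarrow> c) (at_right 0)"
    using assms(1) by (rule pos_tameE)
  obtain as' bs' c' where g: "pos_monomial as'" "pos_monomial bs'" "0 < c'"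
    "((\<lambda>\<epsilon>. g \<epsilon> * monomial bs' \<epsilon> / monomial as' \<epsilon>) \<longlongrightarrow> c') (at_right 0)"
    using assms(2) by (rule pos_tameE)
  show ?thesis
    by (rule pos_tameI[OF _ pos_monomial_append[OF f(1) g(1)] pos_monomial_append[OF f(2) g(2)]
          mult_pos_pos[OF f(3) g(3)]])
      (use tendsto_mult[OF f(4) g(4)] assms in
        \<open>simp_all add: monomial_append pos_tame_pos mult_ac\<close>)
qed

lemma pos_tame_inverse:
  assumes "pos_tame f"
  shows "pos_tame (\<lambda>\<epsilon>. inverse (f \<epsilon>))"
proof -
  obtain as bs c where f: "pos_monomial as" "pos_monomial bs" "0 < c"
    "((\<lambda>\<epsilon>. f \<epsilon> * monomial bs \<epsilon> / monomial as \<epsilon>) \<longlongrightarrow> c) (at_right 0)"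
    using assms by (rule pos_tameE)
  show ?thesis
    by (rule pos_tameI[OF _ f(2) f(1), of _ "inverse c"])
      (use tendsto_inverse[OF f(4)] f(3) assms in \<open>simp_all add: pos_tame_pos field_simps\<close>)
qed

lemma pos_tame_const: "0 < c \<Longrightarrow> pos_tame (\<lambda>_. c)"
  by (rule pos_tameI[OF _ pos_monomial_Nil pos_monomial_Nil, of _ c]) (simp_all add: monomial_def)

text \<open>Regularity of the given chain enters here, for arbitrary lists of pairs; all later
  comparisons of tame functions reduce to this one.\<close>

lemma pos_monomial_quotient_limit:
  assumes "pos_monomial as" "pos_monomial bs"
  shows "\<exists>L::ereal. 0 \<le> L \<and> ((\<lambda>\<epsilon>. ereal (monomial as \<epsilon> / monomial bs \<epsilon>)) \<longlongrightarrow> L) (at_right 0)"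
proof -
  have "asymp_comparable (monomial as) (monomial bs)"
    using regular assms unfolding regular_perturbed_chain_def pos_monomial_def monomial_def[abs_def]
    by blast
  \<comment> \<open>The values at 1 rule out the two alternatives in which one of the products
    vanishes identically.\<close>
  moreover have "monomial as 1 \<noteq> 0" "monomial bs 1 \<noteq> 0"
    using assms pos_monomial_pos[of _ 1] by fastforce+
  ultimately show ?thesis
    unfolding asymp_comparable_def by (meson zero_less_one)
qed

text \<open>The quotient is itself positive and tame, hence a factor with limit in the open
  half-line times a quotient of monomials, whose limit exists in the extended half-line.\<close>

lemma pos_tame_quotient_limit:
  assumes "pos_tame f" "pos_tame g"
  shows "\<exists>L::ereal. 0 \<le> L \<and> ((\<lambda>\<epsilon>. ereal (f \<epsilon> / g \<epsilon>)) \<longlongrightarrow> L) (at_right 0)"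
proof -
  have "pos_tame (\<lambda>\<epsilon>. f \<epsilon> * inverse (g \<epsilon>))"
    by (intro pos_tame_mult pos_tame_inverse assms)
  then obtain as bs c where h: "pos_monomial as" "pos_monomial bs" "0 < c"
    and lim: "((\<lambda>\<epsilon>. f \<epsilon> * inverse (g \<epsilon>) * monomial bs \<epsilon> / monomial as \<epsilon>) \<longlongrightarrow> c) (at_right 0)"
    by (rule pos_tameE)
  obtain L :: ereal where L: "0 \<le> L"
    "((\<lambda>\<epsilon>. ereal (monomial as \<epsilon> / monomial bs \<epsilon>)) \<longlongrightarrow> L) (at_right 0)"
    using pos_monomial_quotient_limit[OF h(1,2)] by blast
  \<comment> \<open>Because \<open>c\<close> is neither zero nor infinite, the product of limits is
    never the indeterminate form of zero times infinity, whatever \<open>L\<close> is.\<close>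
  have "((\<lambda>\<epsilon>. ereal (f \<epsilon> * inverse (g \<epsilon>) * monomial bs \<epsilon> / monomial as \<epsilon>) *
      ereal (monomial as \<epsilon> / monomial bs \<epsilon>)) \<longlongrightarrow> ereal c * L) (at_right 0)"
    using h(3) lim L by (intro tendsto_mult_ereal) auto
  moreover have "eventually (\<lambda>\<epsilon>. ereal (f \<epsilon> * inverse (g \<epsilon>) * monomial bs \<epsilon> / monomial as \<epsilon>) *
      ereal (monomial as \<epsilon> / monomial bs \<epsilon>) = ereal (f \<epsilon> / g \<epsilon>)) (at_right 0)"
    using eventually_at_right_0_pos
  proof eventually_elim
    case (elim \<epsilon>)
    with h(1,2) have "0 < monomial as \<epsilon>" "0 < monomial bs \<epsilon>" by (simp_all add: pos_monomial_pos)
    then show ?case by (simp add: field_simps)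
  qed
  ultimately have "((\<lambda>\<epsilon>. ereal (f \<epsilon> / g \<epsilon>)) \<longlongrightarrow> ereal c * L) (at_right 0)"
    by (rule Lim_transform_eventually)
  moreover have "0 \<le> ereal c * L" using h(3) L(1) by simp
  ultimately show ?thesis by blast
qed

text \<open>A finite limit is kept and an infinite one is inverted, so that sums can be treated with
  real limits only.\<close>

lemma pos_tame_quotient_cases:
  assumes "pos_tame f" "pos_tame g"
  obtains L where "0 \<le> L" "((\<lambda>\<epsilon>. f \<epsilon> / g \<epsilon>) \<longlongrightarrow> L) (at_right 0)"
  | "((\<lambda>\<epsilon>. g \<epsilon> / f \<epsilon>) \<longlongrightarrow> 0) (at_right 0)"
proof -
  obtain L :: ereal where L: "0 \<le> L" "((\<lambda>\<epsilon>. ereal (f \<epsilon> / g \<epsilon>)) \<longlongrightarrow> L) (at_right 0)"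
    using pos_tame_quotient_limit[OF assms] by blast
  show ?thesis
  proof (cases L)
    case (real l)
    then show ?thesis using L that(1)[of l] by simp
  next
    case PInf
    then have "filterlim (\<lambda>\<epsilon>. f \<epsilon> / g \<epsilon>) at_top (at_right 0)"
      using L(2) by (simp add: tendsto_PInfty filterlim_at_top_dense)
    then have "((\<lambda>\<epsilon>. inverse (f \<epsilon> / g \<epsilon>)) \<longlongrightarrow> 0) (at_right 0)"
      by (rule tendsto_inverse_0_at_top)
    then show ?thesis using that(2) by simp
  next
    case MInf
    then show ?thesis using L(1) by simp
  qed
qed

text \<open>The sum is \<open>(f / g + 1) * g\<close>, so it inherits the leading monomials of
  \<open>g\<close>, with constant \<open>(L + 1) * c\<close>. Nonnegativity of \<open>L\<close>
  keeps this constant positive: there is no cancellation.\<close>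

lemma pos_tame_add_dominated:
  assumes f: "pos_tame f" and g: "pos_tame g"
    and L: "0 \<le> L" "((\<lambda>\<epsilon>. f \<epsilon> / g \<epsilon>) \<longlongrightarrow> L) (at_right 0)"
  shows "pos_tame (\<lambda>\<epsilon>. f \<epsilon> + g \<epsilon>)"
proof -
  obtain as bs c where m: "pos_monomial as" "pos_monomial bs" "0 < c"
    and lim: "((\<lambda>\<epsilon>. g \<epsilon> * monomial bs \<epsilon> / monomial as \<epsilon>) \<longlongrightarrow> c) (at_right 0)"
    using g by (rule pos_tameE)
  have "((\<lambda>\<epsilon>. (f \<epsilon> / g \<epsilon> + 1) * (g \<epsilon> * monomial bs \<epsilon> / monomial as \<epsilon>)) \<longlongrightarrow> (L + 1) * c) (at_right 0)"
    by (intro tendsto_intros L lim)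
  then have "((\<lambda>\<epsilon>. (f \<epsilon> + g \<epsilon>) * monomial bs \<epsilon> / monomial as \<epsilon>) \<longlongrightarrow> (L + 1) * c) (at_right 0)"
  proof (rule Lim_transform_eventually)
    show "eventually (\<lambda>\<epsilon>. (f \<epsilon> / g \<epsilon> + 1) * (g \<epsilon> * monomial bs \<epsilon> / monomial as \<epsilon>) =
        (f \<epsilon> + g \<epsilon>) * monomial bs \<epsilon> / monomial as \<epsilon>) (at_right 0)"
      using eventually_at_right_0_pos
    proof eventually_elim
      case (elim \<epsilon>)
      have "(f \<epsilon> / g \<epsilon> + 1) * g \<epsilon> = f \<epsilon> + g \<epsilon>"
        using pos_tame_pos[OF g elim] by (simp add: field_simps)
      then show ?case by (metis mult.assoc times_divide_eq_right)
    qed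
  qed
  then show ?thesis
    by (rule pos_tameI[OF _ m(1,2), rotated -1])
      (use m(3) L(1) in \<open>simp_all add: add_pos_pos pos_tame_pos[OF f] pos_tame_pos[OF g]\<close>)
qed

lemma pos_tame_add:
  assumes "pos_tame f" "pos_tame g"
  shows "pos_tame (\<lambda>\<epsilon>. f \<epsilon> + g \<epsilon>)"
  using assms
proof (cases rule: pos_tame_quotient_cases)
  case (1 L)
  then show ?thesis using pos_tame_add_dominated assms by blast
next
  case 2
  then have "pos_tame (\<lambda>\<epsilon>. g \<epsilon> + f \<epsilon>)"
    using pos_tame_add_dominated[OF assms(2,1), of 0] by simp
  then show ?thesis by (simp add: add.commute)
qed

section \<open>Tame functions, with the zero function included\<close>

lemma tame_zero: "tame (\<lambda>_. 0)"
  by (simp add: tame_def)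

lemma tame_const: "0 \<le> c \<Longrightarrow> tame (\<lambda>_. c)"
  using pos_tame_const[of c] by (cases "c = 0") (simp_all add: tame_def)

lemma tame_add:
  assumes "tame f" "tame g"
  shows "tame (\<lambda>\<epsilon>. f \<epsilon> + g \<epsilon>)"
proof -
  consider "\<forall>\<epsilon>>0. f \<epsilon> = 0" | "\<forall>\<epsilon>>0. g \<epsilon> = 0" | "pos_tame f" "pos_tame g"
    using assms unfolding tame_def by blast
  then show ?thesis
  proof cases
    case 1
    then show ?thesis using tame_cong[OF assms(2)] by simp
  next
    case 2
    then show ?thesis using tame_cong[OF assms(1)] by simp
  next
    case 3
    then show ?thesis by (simp add: tame_def pos_tame_add)
  qed
qed

lemma tame_mult:
  assumes "tame f" "tame g"
  shows "tame (\<lambda>\<epsilon>. f \<epsilon> * g \<epsilon>)"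
proof (cases "pos_tame f \<and> pos_tame g")
  case True
  then show ?thesis by (simp add: tame_def pos_tame_mult)
next
  case False
  then have "\<forall>\<epsilon>>0. f \<epsilon> * g \<epsilon> = 0" using assms by (auto simp: tame_def)
  then show ?thesis by (simp add: tame_def)
qed

text \<open>The identically zero case rests on the convention \<open>inverse 0 = 0\<close>; it makes
  quotients of tame functions tame without case distinctions later on.\<close>

lemma tame_inverse:
  assumes "tame f"
  shows "tame (\<lambda>\<epsilon>. inverse (f \<epsilon>))"
proof (cases "pos_tame f")
  case True
  then show ?thesis by (simp add: tame_def pos_tame_inverse)
next
  case False
  then have "\<forall>\<epsilon>>0. inverse (f \<epsilon>) = 0" using assms by (auto simp: tame_def)
  then show ?thesis by (simp add: tame_def)
qed

lemma tame_divide: "tame f \<Longrightarrow> tame g \<Longrightarrow> tame (\<lambda>\<epsilon>. f \<epsilon> / g \<epsilon>)"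
  unfolding divide_inverse by (intro tame_mult tame_inverse)

lemma tame_sum: "finite A \<Longrightarrow> (\<And>a. a \<in> A \<Longrightarrow> tame (f a)) \<Longrightarrow> tame (\<lambda>\<epsilon>. \<Sum>a\<in>A. f a \<epsilon>)"
  by (induction A rule: finite_induct) (simp_all add: tame_zero tame_add)

lemma tame_prod_list: "(\<And>a. a \<in> set as \<Longrightarrow> tame (f a)) \<Longrightarrow> tame (\<lambda>\<epsilon>. \<Prod>a\<leftarrow>as. f a \<epsilon>)"
  by (induction as) (simp_all add: tame_const tame_mult)

text \<open>A positive entry is its own leading monomial, with constant 1.\<close>

lemma tame_entry:
  assumes "x \<in> S" "y \<in> S"
  shows "tame (\<lambda>\<epsilon>. P \<epsilon> x y)"
proof -
  \<comment> \<open>Comparing the entry with itself says nothing new about limits, but it forces the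
    dichotomy: positive for all positive \<open>\<epsilon>\<close> or zero for all of them.\<close>
  have "asymp_comparable (\<lambda>\<epsilon>. \<Prod>(x, y)\<leftarrow>[(x, y)]. P \<epsilon> x y) (\<lambda>\<epsilon>. \<Prod>(x, y)\<leftarrow>[(x, y)]. P \<epsilon> x y)"
    by (rule regular[unfolded regular_perturbed_chain_def, THEN conjunct2, rule_format])
      (use assms in auto)
  then have "(\<forall>\<epsilon>>0. 0 < P \<epsilon> x y) \<or> (\<forall>\<epsilon>>0. P \<epsilon> x y = 0)"
    unfolding asymp_comparable_def by simp blast
  moreover have "pos_tame (\<lambda>\<epsilon>. P \<epsilon> x y)" if pos: "\<forall>\<epsilon>>0. 0 < P \<epsilon> x y"
  proof (rule pos_tameI[OF _ _ pos_monomial_Nil zero_less_one])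
    show "pos_monomial [(x, y)]" using assms pos by (simp add: pos_monomial_def monomial_def)
    show "((\<lambda>\<epsilon>. P \<epsilon> x y * monomial [] \<epsilon> / monomial [(x, y)] \<epsilon>) \<longlongrightarrow> 1) (at_right 0)"
      by (rule Lim_transform_eventually[OF tendsto_const])
        (use eventually_at_right_0_pos pos in \<open>auto elim!: eventually_mono simp: monomial_def\<close>)
  qed (use pos in simp)
  ultimately show ?thesis unfolding tame_def by blast
qed

lemma tame_asymp_comparable:
  assumes "tame f" "tame g"
  shows "asymp_comparable f g"
proof (cases "pos_tame f \<and> pos_tame g")
  case True
  then show ?thesis
    using pos_tame_quotient_limit[of f g] unfolding asymp_comparable_def
    by (blast intro: pos_tame_pos)
next
  case False
  then show ?thesis using assms unfolding tame_def asymp_comparable_def by blast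
qed

text \<open>Comparison with the constant 1 gives a limit in the extended half-line, and the bound
  \<open>C\<close> excludes infinity.\<close>

lemma tame_bounded_convergent:
  assumes f: "tame f" and le: "\<And>\<epsilon>. 0 < \<epsilon> \<Longrightarrow> f \<epsilon> \<le> C"
  shows "\<exists>l. (f \<longlongrightarrow> l) (at_right 0)"
proof (cases "pos_tame f")
  case True
  obtain L :: ereal where L: "0 \<le> L" "((\<lambda>\<epsilon>. ereal (f \<epsilon> / 1)) \<longlongrightarrow> L) (at_right 0)"
    using pos_tame_quotient_limit[OF True pos_tame_const[of 1]] by auto
  have "L \<le> ereal C"
    by (rule tendsto_upperbound[OF L(2)])
      (use eventually_at_right_0_pos le in \<open>auto elim!: eventually_mono\<close>)
  with L(1) obtain l where "L = ereal l" by (cases L) auto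
  then show ?thesis using L(2) by auto
next
  case False
  then have "\<forall>\<epsilon>>0. f \<epsilon> = 0" using f by (simp add: tame_def)
  then have "(f \<longlongrightarrow> 0) (at_right 0)"
    by (intro Lim_transform_eventually[OF tendsto_const])
      (use eventually_at_right_0_pos in \<open>auto elim!: eventually_mono\<close>)
  then show ?thesis ..
qed

section \<open>Tame chains, the invariant kept by every construction below\<close>

definition tame_chain :: "'a set \<Rightarrow> (real \<Rightarrow> 'a \<Rightarrow> 'a \<Rightarrow> real) \<Rightarrow> bool" where
  "tame_chain A Q \<longleftrightarrow> (\<forall>\<epsilon>>0. stochastic A (Q \<epsilon>) \<and> irreducible_chain A (Q \<epsilon>)) \<and>
    (\<forall>a\<in>A. \<forall>b\<in>A. tame (\<lambda>\<epsilon>. Q \<epsilon> a b))"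

text \<open>Entries of a stochastic matrix are at most 1, so tameness makes them converge; the
  limits form the matrix at 0, and stochasticity passes to the limit. Products of entries are tame,
  hence comparable.\<close>

lemma tame_chain_regular_perturbed_family:
  assumes A: "finite A" and Q: "tame_chain A Q"
  shows "regular_perturbed_family A Q"
proof -
  have st: "stochastic A (Q \<epsilon>)" and irr: "irreducible_chain A (Q \<epsilon>)" if "0 < \<epsilon>" for \<epsilon>
    using Q that by (simp_all add: tame_chain_def)
  have tame: "tame (\<lambda>\<epsilon>. Q \<epsilon> a b)" if "a \<in> A" "b \<in> A" for a b
    using Q that by (simp add: tame_chain_def)
  have "\<exists>l. ((\<lambda>\<epsilon>. Q \<epsilon> a b) \<longlongrightarrow> l) (at_right 0)" if "a \<in> A" "b \<in> A" for a b
  proof (rule tame_bounded_convergent[OF tame[OF that]])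
    fix \<epsilon> :: real assume "0 < \<epsilon>"
    then have "Q \<epsilon> a b \<le> (\<Sum>y\<in>A. Q \<epsilon> a y)"
      using st that A by (intro member_le_sum) (auto simp: stochastic_def)
    then show "Q \<epsilon> a b \<le> 1" using st[OF \<open>0 < \<epsilon>\<close>] that by (simp add: stochastic_def)
  qed
  then have "\<forall>a b. \<exists>l. a \<in> A \<longrightarrow> b \<in> A \<longrightarrow> ((\<lambda>\<epsilon>. Q \<epsilon> a b) \<longlongrightarrow> l) (at_right 0)"
    by blast
  then obtain Q0 where lim: "\<And>a b. a \<in> A \<Longrightarrow> b \<in> A \<Longrightarrow> ((\<lambda>\<epsilon>. Q \<epsilon> a b) \<longlongrightarrow> Q0 a b) (at_right 0)"
    by metis
  let ?Q = "Q(0 := Q0)"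
  have pos: "?Q \<epsilon> = Q \<epsilon>" if "0 < \<epsilon>" for \<epsilon> using that by simp
  have st0: "stochastic A Q0"
    unfolding stochastic_def
  proof (intro ballI conjI)
    fix a assume a: "a \<in> A"
    show "0 \<le> Q0 a b" if "b \<in> A" for b
      by (rule tendsto_lowerbound[OF lim[OF a that]])
        (use eventually_at_right_0_pos st a that in
          \<open>auto elim!: eventually_mono simp: stochastic_def\<close>)
    have "((\<lambda>\<epsilon>. \<Sum>b\<in>A. Q \<epsilon> a b) \<longlongrightarrow> (\<Sum>b\<in>A. Q0 a b)) (at_right 0)"
      using lim a by (intro tendsto_sum) auto
    moreover have "((\<lambda>\<epsilon>. \<Sum>b\<in>A. Q \<epsilon> a b) \<longlongrightarrow> 1) (at_right 0)"
      by (rule Lim_transform_eventually[OF tendsto_const])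
        (use eventually_at_right_0_pos st a in \<open>auto elim!: eventually_mono simp: stochastic_def\<close>)
    ultimately show "(\<Sum>b\<in>A. Q0 a b) = 1"
      by (rule tendsto_unique[rotated]) simp
  qed
  have "perturbed_chain A ?Q"
    unfolding perturbed_chain_def
  proof (intro conjI allI impI ballI)
    show "stochastic A (?Q \<epsilon>)" if "0 \<le> \<epsilon>" for \<epsilon>
      using that st0 st[of \<epsilon>] by (cases "\<epsilon> = 0") simp_all
    show "((\<lambda>\<epsilon>. ?Q \<epsilon> a b) \<longlongrightarrow> ?Q 0 a b) (at_right 0)" if "a \<in> A" "b \<in> A" for a b
    proof (rule Lim_transform_eventually)
      show "((\<lambda>\<epsilon>. Q \<epsilon> a b) \<longlongrightarrow> ?Q 0 a b) (at_right 0)" using lim[OF that] by simp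
      show "\<forall>\<^sub>F \<epsilon> in at_right 0. Q \<epsilon> a b = ?Q \<epsilon> a b"
        by (rule eventually_mono[OF eventually_at_right_0_pos]) simp
    qed
  qed
  moreover have "irreducible_chain A (?Q \<epsilon>)" if "0 < \<epsilon>" for \<epsilon>
    using irr that by simp
  moreover have "asymp_comparable (\<lambda>\<epsilon>. \<Prod>(x, y)\<leftarrow>as. ?Q \<epsilon> x y) (\<lambda>\<epsilon>. \<Prod>(x, y)\<leftarrow>bs. ?Q \<epsilon> x y)"
    if "set as \<subseteq> A \<times> A" "set bs \<subseteq> A \<times> A" for as bs
  proof -
    have "tame (\<lambda>\<epsilon>. \<Prod>(x, y)\<leftarrow>cs. ?Q \<epsilon> x y)" if "set cs \<subseteq> A \<times> A" for cs
    proof -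
      have "tame (\<lambda>\<epsilon>. \<Prod>c\<leftarrow>cs. Q \<epsilon> (fst c) (snd c))"
        using that tame by (intro tame_prod_list) auto
      then show ?thesis
        by (rule tame_cong) (simp add: case_prod_beta')
    qed
    then show ?thesis using that by (intro tame_asymp_comparable)
  qed
  ultimately have "regular_perturbed_chain A ?Q"
    unfolding regular_perturbed_chain_def irreducibly_perturbed_chain_def by blast
  then show ?thesis unfolding regular_perturbed_family_def by blast
qed

end

section \<open>State elimination\<close>

text \<open>For stochastic \<open>q\<close> this is the chain watched only while outside
  \<open>u\<close>: the geometric series over the time spent in \<open>u\<close> sums to
  \<open>1 / (1 - q u u)\<close>, and the denominator is this difference written as a sum.\<close>

definition eliminate :: "'a set \<Rightarrow> 'a \<Rightarrow> ('a \<Rightarrow> 'a \<Rightarrow> real) \<Rightarrow> 'a \<Rightarrow> 'a \<Rightarrow> real" where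
  "eliminate V u q x y = q x y + q x u * q u y / (\<Sum>z\<in>V - {u}. q u z)"

text \<open>Otherwise \<open>u\<close> would be absorbing, and \<open>a\<close> could not be reached
  from it.\<close>

lemma irreducible_exit_pos:
  assumes V: "finite V" "u \<in> V" "a \<in> V" "a \<noteq> u"
    and q: "stochastic V q" and irr: "irreducible_chain V q"
  shows "0 < (\<Sum>z\<in>V - {u}. q u z)"
proof -
  have nn: "0 \<le> q u z" if "z \<in> V" for z using q V that by (simp add: stochastic_def)
  have "\<exists>z\<in>V - {u}. 0 < q u z"
  proof (rule ccontr)
    assume none: "\<not> (\<exists>z\<in>V - {u}. 0 < q u z)"
    have "(u, a) \<in> (step_rel V q)\<^sup>*" using irr V by (simp add: irreducible_chain_def)
    then have "a = u"
      by (induction rule: rtrancl_induct) (use none in \<open>auto simp: step_rel_def\<close>)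
    with V show False by simp
  qed
  then obtain z where "z \<in> V - {u}" "0 < q u z" by blast
  then show ?thesis using V nn by (intro sum_pos2[of _ z]) auto
qed

text \<open>The mass \<open>q x u\<close> is redistributed over the other states in the proportions
  of the row of \<open>u\<close>, so row sums are preserved.\<close>

lemma stochastic_eliminate:
  assumes V: "finite V" "u \<in> V" and q: "stochastic V q"
    and pos: "0 < (\<Sum>z\<in>V - {u}. q u z)"
  shows "stochastic (V - {u}) (eliminate V u q)"
  unfolding stochastic_def
proof (intro ballI conjI)
  let ?s = "\<Sum>z\<in>V - {u}. q u z"
  fix x assume x: "x \<in> V - {u}"
  show "0 \<le> eliminate V u q x y" if "y \<in> V - {u}" for y
    using q x that V pos unfolding eliminate_def stochastic_def
    by (intro add_nonneg_nonneg divide_nonneg_pos mult_nonneg_nonneg) auto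
  have "(\<Sum>y\<in>V - {u}. eliminate V u q x y) = (\<Sum>y\<in>V - {u}. q x y) + q x u * ?s / ?s"
    by (simp add: eliminate_def sum.distrib sum_distrib_left sum_divide_distrib)
  also have "\<dots> = (\<Sum>y\<in>V. q x y)"
    using pos V by (simp add: sum.remove[of V u])
  also have "\<dots> = 1" using q x by (simp add: stochastic_def)
  finally show "(\<Sum>y\<in>V - {u}. eliminate V u q x y) = 1" .
qed

text \<open>A path of the old chain becomes a path of the new one by cutting out its visits to
  \<open>u\<close>: an excursion through \<open>u\<close> turns into a single step.\<close>

lemma irreducible_eliminate:
  assumes V: "finite V" "u \<in> V" and q: "stochastic V q" and irr: "irreducible_chain V q"
    and pos: "0 < (\<Sum>z\<in>V - {u}. q u z)"
  shows "irreducible_chain (V - {u}) (eliminate V u q)"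
  unfolding irreducible_chain_def
proof (intro ballI)
  let ?R = "step_rel (V - {u}) (eliminate V u q)"
  have nn: "0 \<le> q a b" if "a \<in> V" "b \<in> V" for a b using q that by (simp add: stochastic_def)
  fix x y assume x: "x \<in> V - {u}" and y: "y \<in> V - {u}"
  \<comment> \<open>The invariant of the induction along a path: while the path sits in
    \<open>u\<close>, it remembers the state \<open>w\<close> from which \<open>u\<close> was
    entered, so that the exit from \<open>u\<close> can be replaced by a step from
    \<open>w\<close>.\<close>
  have path: "(x, z) \<in> (step_rel V q)\<^sup>* \<Longrightarrow>
    (if z = u then \<exists>w\<in>V - {u}. (x, w) \<in> ?R\<^sup>* \<and> 0 < q w u else (x, z) \<in> ?R\<^sup>*)" for z
  proof (induction rule: rtrancl_induct)
    case base
    then show ?case using x by simp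
  next
    case (step z z')
    then have z: "z \<in> V" "z' \<in> V" "0 < q z z'" by (auto simp: step_rel_def)
    consider "z = u" "z' = u" | "z = u" "z' \<noteq> u" | "z \<noteq> u" "z' = u" | "z \<noteq> u" "z' \<noteq> u" by blast
    then show ?case
    proof cases
      case 1
      then show ?thesis using step.IH by simp
    next
      case 2
      then obtain w where w: "w \<in> V - {u}" "(x, w) \<in> ?R\<^sup>*" "0 < q w u" using step.IH by auto
      have "0 < eliminate V u q w z'"
        unfolding eliminate_def using w z 2 pos nn
        by (intro add_nonneg_pos divide_pos_pos mult_pos_pos) auto
      then have "(w, z') \<in> ?R" using w z 2 by (simp add: step_rel_def)
      then show ?thesis using w 2 by auto
    next
      case 3
      then show ?thesis using step.IH z by auto
    next
      case 4
      have "0 < eliminate V u q z z'"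
        unfolding eliminate_def using z 4 pos nn V
        by (intro add_pos_nonneg divide_nonneg_pos mult_nonneg_nonneg) auto
      then have "(z, z') \<in> ?R" using z 4 by (simp add: step_rel_def)
      then show ?thesis using step.IH 4 by auto
    qed
  qed
  show "(x, y) \<in> ?R\<^sup>*" using path[of y] irr x y by (simp add: irreducible_chain_def)
qed

text \<open>One step of Gaussian elimination: the equation at \<open>u\<close> is solved for
  \<open>r u\<close> and substituted into the others. The unknowns on the right are indexed by
  \<open>U\<close>, whereas the pivot sums the row over all of \<open>V - {u}\<close>.\<close>

lemma eliminate_hitting_eq:
  assumes V: "finite V" "u \<in> V" "U \<subseteq> V" "u \<in> U" and q: "stochastic V q"
    and pos: "0 < (\<Sum>z\<in>V - {u}. q u z)"
    and r: "\<And>x. x \<in> V \<Longrightarrow> r x = q x y + (\<Sum>v\<in>U. q x v * r v)"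
    and x: "x \<in> V"
  shows "r x = eliminate V u q x y + (\<Sum>v\<in>U - {u}. eliminate V u q x v * r v)"
proof -
  let ?s = "\<Sum>z\<in>V - {u}. q u z"
  have U: "finite U" using V by (meson finite_subset)
  have split: "r w = q w y + q w u * r u + (\<Sum>v\<in>U - {u}. q w v * r v)" if "w \<in> V" for w
    using r[OF that] U V by (simp add: sum.remove[of U u])
  \<comment> \<open>Row sum 1 identifies the pivot of the equation for \<open>r u\<close> with the
    positive number \<open>?s\<close>, by which one can divide.\<close>
  have "?s = 1 - q u u"
    using q V by (simp add: stochastic_def sum.remove[of V u] algebra_simps)
  then have "?s * r u = r u - q u u * r u" by (simp only: left_diff_distrib mult_1_left)
  also have "\<dots> = q u y + (\<Sum>v\<in>U - {u}. q u v * r v)" using split[OF V(2)] by linarith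
  finally have ru: "r u = (q u y + (\<Sum>v\<in>U - {u}. q u v * r v)) / ?s"
    using pos by (simp add: field_simps)
  have "(\<Sum>v\<in>U - {u}. eliminate V u q x v * r v) =
      (\<Sum>v\<in>U - {u}. q x v * r v) + q x u * (\<Sum>v\<in>U - {u}. q u v * r v) / ?s"
    by (simp add: eliminate_def algebra_simps sum.distrib sum_distrib_left sum_divide_distrib)
  then show ?thesis
    using split[OF x] unfolding ru eliminate_def by (simp add: add_divide_distrib algebra_simps)
qed

section \<open>Elimination applied to tame families\<close>

context regular_chain
begin

lemma tame_eliminate:
  assumes "finite V" "u \<in> V" "x \<in> V" "y \<in> V"
    and "\<And>a b. a \<in> V \<Longrightarrow> b \<in> V \<Longrightarrow> tame (\<lambda>\<epsilon>. q \<epsilon> a b)"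
  shows "tame (\<lambda>\<epsilon>. eliminate V u (q \<epsilon>) x y)"
  unfolding eliminate_def using assms
  by (intro tame_add tame_divide tame_mult tame_sum) auto

text \<open>Induction on \<open>U\<close> with \<open>q\<close> generalized: eliminating one state
  changes the matrix but not the solution \<open>r\<close>. Once \<open>U\<close> is exhausted, the
  equations say that \<open>r\<close> equals the matrix reached. They are assumed at states of
  \<open>U\<close> as well, since the one at \<open>u\<close> has to be solved for
  \<open>r \<epsilon> u y\<close>.\<close>

lemma tame_chain_hitting:
  assumes "finite U" "finite A" "A \<noteq> {}" "U \<inter> A = {}" "tame_chain (U \<union> A) q"
    and "\<And>\<epsilon> x y. 0 < \<epsilon> \<Longrightarrow> x \<in> U \<union> A \<Longrightarrow> y \<in> A \<Longrightarrow>
      r \<epsilon> x y = q \<epsilon> x y + (\<Sum>u\<in>U. q \<epsilon> x u * r \<epsilon> u y)"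
  shows "tame_chain A r"
  using assms
proof (induction U arbitrary: q rule: finite_induct)
  case empty
  have eq: "r \<epsilon> x y = q \<epsilon> x y" if "0 < \<epsilon>" "x \<in> A" "y \<in> A" for \<epsilon> x y
    using empty.prems(5)[OF that(1) _ that(3), of x] that by simp
  have "stochastic A (r \<epsilon>)" if "0 < \<epsilon>" for \<epsilon>
    using empty.prems(4) that eq by (simp add: tame_chain_def stochastic_def)
  moreover have "step_rel A (r \<epsilon>) = step_rel A (q \<epsilon>)" if "0 < \<epsilon>" for \<epsilon>
    using eq that by (auto simp: step_rel_def)
  then have "irreducible_chain A (r \<epsilon>)" if "0 < \<epsilon>" for \<epsilon>
    using empty.prems(4) that by (simp add: tame_chain_def irreducible_chain_def)
  moreover have "tame (\<lambda>\<epsilon>. r \<epsilon> x y)" if "x \<in> A" "y \<in> A" for x y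
    by (rule tame_cong[of "\<lambda>\<epsilon>. q \<epsilon> x y"])
      (use empty.prems(4) that eq in \<open>simp_all add: tame_chain_def\<close>)
  ultimately show ?case by (simp add: tame_chain_def)
next
  case (insert u U)
  let ?V = "insert u U \<union> A"
  let ?q = "\<lambda>\<epsilon>. eliminate ?V u (q \<epsilon>)"
  have V: "finite ?V" "u \<in> ?V" "?V - {u} = U \<union> A"
    using insert.hyps insert.prems by auto
  have st: "stochastic ?V (q \<epsilon>)" and irr: "irreducible_chain ?V (q \<epsilon>)" if "0 < \<epsilon>" for \<epsilon>
    using insert.prems(4) that by (simp_all add: tame_chain_def)
  \<comment> \<open>A state of \<open>A\<close> differs from every state of \<open>U\<close>, so the
    chain can leave \<open>u\<close> and the pivot is positive.\<close>
  obtain a where a: "a \<in> A" using insert.prems(2) by blast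
  have pos: "0 < (\<Sum>z\<in>?V - {u}. q \<epsilon> u z)" if "0 < \<epsilon>" for \<epsilon>
    by (rule irreducible_exit_pos[OF V(1,2) _ _ st[OF that] irr[OF that], of a])
      (use a insert.prems(3) in auto)
  show ?case
  proof (rule insert.IH[of ?q])
    show "tame_chain (U \<union> A) ?q"
      unfolding tame_chain_def
    proof (intro conjI allI impI ballI)
      fix \<epsilon> :: real assume e: "0 < \<epsilon>"
      show "stochastic (U \<union> A) (?q \<epsilon>)"
        using stochastic_eliminate[OF V(1,2) st[OF e] pos[OF e]] unfolding V(3) .
      show "irreducible_chain (U \<union> A) (?q \<epsilon>)"
        using irreducible_eliminate[OF V(1,2) st[OF e] irr[OF e] pos[OF e]] unfolding V(3) .
    next
      fix x y assume "x \<in> U \<union> A" "y \<in> U \<union> A"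
      then show "tame (\<lambda>\<epsilon>. ?q \<epsilon> x y)"
        using insert.prems(4) V(1) by (intro tame_eliminate) (auto simp: tame_chain_def)
    qed
    fix \<epsilon> x y assume e: "0 < (\<epsilon>::real)" and x: "x \<in> U \<union> A" and y: "y \<in> A"
    have "r \<epsilon> x y = ?q \<epsilon> x y + (\<Sum>v\<in>insert u U - {u}. ?q \<epsilon> x v * r \<epsilon> v y)"
      by (rule eliminate_hitting_eq[OF V(1,2) _ _ st[OF e] pos[OF e]])
        (use insert.prems(5)[OF e _ y] x in auto)
    then show "r \<epsilon> x y = ?q \<epsilon> x y + (\<Sum>v\<in>U. ?q \<epsilon> x v * r \<epsilon> v y)"
      using insert.hyps by simp
  qed (use insert.prems in auto)
qed

end


section \<open>First-step equations for the return probabilities\<close>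

text \<open>\<open>first_hit p U z n x\<close> is the probability, starting in \<open>x\<close>, of spending the times
  \<open>1, \<dots>, n\<close> in \<open>U\<close> and being in \<open>z\<close> at time \<open>n + 1\<close>.\<close>

primrec first_hit :: "('a \<Rightarrow> 'a \<Rightarrow> real) \<Rightarrow> 'a set \<Rightarrow> 'a \<Rightarrow> nat \<Rightarrow> 'a \<Rightarrow> real" where
  "first_hit p U z 0 x = p x z"
| "first_hit p U z (Suc n) x = (\<Sum>v\<in>U. p x v * first_hit p U z n v)"

section \<open>Probabilities of path events\<close>

lemma path_measure_space:
  assumes "is_path_measure S p x M"
  shows "space M = UNIV \<rightarrow> S"
proof -
  have "space M = space (\<Pi>\<^sub>M i\<in>(UNIV :: nat set). count_space S)"
    using assms by (intro sets_eq_imp_space_eq) (simp add: is_path_measure_def)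
  then show ?thesis by (auto simp: space_PiM PiE_def)
qed

lemma path_measure_pred:
  assumes M: "is_path_measure S p x M"
  shows "Measurable.pred M (\<lambda>\<omega>. Q (\<omega> i))"
proof -
  have sM: "sets M = sets (\<Pi>\<^sub>M i\<in>(UNIV :: nat set). count_space S)"
    using M by (simp add: is_path_measure_def)
  have "(\<lambda>\<omega>. \<omega> i) \<in> M \<rightarrow>\<^sub>M count_space S"
    unfolding measurable_cong_sets[OF sM refl] by (rule measurable_component_singleton) simp
  then show ?thesis
    by (rule measurable_compose) simp
qed

lemma path_measure_cylinder:
  assumes "is_path_measure S p x M" "\<forall>i\<le>n. y i \<in> S" "y 0 = x"
  shows "measure M {\<omega> \<in> space M. \<forall>i\<le>n. \<omega> i = y i} = (\<Prod>i<n. p (y i) (y (Suc i)))"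
  using assms by (simp add: is_path_measure_def)

text \<open>The prefix \<open>y\<close> has arbitrary length so that cylinder probabilities suffice
  and no Markov property has to be set up: the induction on \<open>n\<close> moves the first free
  state into the prefix.\<close>

lemma path_measure_first_hit:
  assumes S: "finite S" "U \<subseteq> S" "z \<in> S" and M: "is_path_measure S p x M"
    and y: "\<forall>i\<le>m. y i \<in> S" "y 0 = x"
  shows "measure M {\<omega> \<in> space M. (\<forall>i\<le>m. \<omega> i = y i) \<and> (\<forall>j. m < j \<and> j \<le> m + n \<longrightarrow> \<omega> j \<in> U) \<and>
      \<omega> (Suc (m + n)) = z} = (\<Prod>i<m. p (y i) (y (Suc i))) * first_hit p U z n (y m)"
  using y
proof (induction n arbitrary: m y)
  case 0
  let ?y = "y(Suc m := z)"
  have "{\<omega> \<in> space M. (\<forall>i\<le>m. \<omega> i = y i) \<and> (\<forall>j. m < j \<and> j \<le> m + 0 \<longrightarrow> \<omega> j \<in> U) \<and>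
      \<omega> (Suc (m + 0)) = z} = {\<omega> \<in> space M. \<forall>i\<le>Suc m. \<omega> i = ?y i}"
    by (auto simp: le_Suc_eq)
  also have "measure M \<dots> = (\<Prod>i<Suc m. p (?y i) (?y (Suc i)))"
    by (rule path_measure_cylinder[OF M]) (use 0 S in auto)
  also have "\<dots> = (\<Prod>i<m. p (y i) (y (Suc i))) * p (y m) z"
    by simp
  finally show ?case by simp
next
  case (Suc n)
  interpret prob_space M using M by (simp add: is_path_measure_def)
  note [measurable] = path_measure_pred[OF M]
  \<comment> \<open>The event is split by the state \<open>v\<close> at time \<open>m + 1\<close>;
    each piece has a prefix longer by one and one free time less.\<close>
  define C where "C v = {\<omega> \<in> space M. (\<forall>i\<le>Suc m. \<omega> i = (y(Suc m := v)) i) \<and>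
      (\<forall>j. Suc m < j \<and> j \<le> Suc m + n \<longrightarrow> \<omega> j \<in> U) \<and> \<omega> (Suc (Suc m + n)) = z}" for v
  have C_sets: "C v \<in> sets M" for v
    unfolding C_def by measurable
  have "{\<omega> \<in> space M. (\<forall>i\<le>m. \<omega> i = y i) \<and> (\<forall>j. m < j \<and> j \<le> m + Suc n \<longrightarrow> \<omega> j \<in> U) \<and>
      \<omega> (Suc (m + Suc n)) = z} = (\<Union>v\<in>U. C v)"
  proof (intro set_eqI iffI)
    fix \<omega>
    assume "\<omega> \<in> {\<omega> \<in> space M. (\<forall>i\<le>m. \<omega> i = y i) \<and>
      (\<forall>j. m < j \<and> j \<le> m + Suc n \<longrightarrow> \<omega> j \<in> U) \<and> \<omega> (Suc (m + Suc n)) = z}"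
    then have "\<omega> (Suc m) \<in> U" "\<omega> \<in> C (\<omega> (Suc m))" by (auto simp: C_def le_Suc_eq)
    then show "\<omega> \<in> (\<Union>v\<in>U. C v)" by blast
  next
    fix \<omega> assume "\<omega> \<in> (\<Union>v\<in>U. C v)"
    then obtain v where v: "v \<in> U" "\<omega> \<in> C v" by blast
    have "\<omega> j \<in> U" if "m < j" "j \<le> m + Suc n" for j
      using v that by (cases "j = Suc m") (auto simp: C_def)
    moreover have "\<omega> i = y i" if "i \<le> m" for i
      using v(2) that by (auto simp: C_def)
    ultimately show "\<omega> \<in> {\<omega> \<in> space M. (\<forall>i\<le>m. \<omega> i = y i) \<and>
      (\<forall>j. m < j \<and> j \<le> m + Suc n \<longrightarrow> \<omega> j \<in> U) \<and> \<omega> (Suc (m + Suc n)) = z}"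
      using v(2) by (simp add: C_def)
  qed
  also have "measure M (\<Union>v\<in>U. C v) = (\<Sum>v\<in>U. measure M (C v))"
  proof (rule finite_measure_finite_Union)
    show "disjoint_family_on C U"
      by (auto simp: disjoint_family_on_def C_def)
  qed (use S C_sets in \<open>auto intro: finite_subset\<close>)
  also have "\<dots> = (\<Sum>v\<in>U. (\<Prod>i<m. p (y i) (y (Suc i))) * (p (y m) v * first_hit p U z n v))"
  proof (rule sum.cong[OF refl])
    fix v assume v: "v \<in> U"
    have "measure M (C v) =
        (\<Prod>i<Suc m. p ((y(Suc m := v)) i) ((y(Suc m := v)) (Suc i))) *
        first_hit p U z n ((y(Suc m := v)) (Suc m))"
      unfolding C_def by (rule Suc.IH) (use Suc.prems S v in auto)
    then show "measure M (C v) =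
        (\<Prod>i<m. p (y i) (y (Suc i))) * (p (y m) v * first_hit p U z n v)"
      by (simp add: mult.assoc)
  qed
  also have "\<dots> = (\<Prod>i<m. p (y i) (y (Suc i))) * first_hit p U z (Suc n) (y m)"
    by (simp add: sum_distrib_left)
  finally show ?case .
qed

text \<open>A finite infimum of times is attained, at the least admissible time; the empty set has
  infimum infinity.\<close>

lemma return_time_eq_enat_iff:
  "return_time A \<omega> = enat k \<longleftrightarrow> 0 < k \<and> \<omega> k \<in> A \<and> (\<forall>j. 0 < j \<and> j < k \<longrightarrow> \<omega> j \<notin> A)"
    (is "_ \<longleftrightarrow> ?first k")
proof -
  have first: "return_time A \<omega> = enat k" if "?first k" for k
    unfolding return_time_def
  proof (rule antisym)
    show "Inf {enat n |n. 0 < n \<and> \<omega> n \<in> A} \<le> enat k"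
      using that by (intro Inf_lower) blast
    show "enat k \<le> Inf {enat n |n. 0 < n \<and> \<omega> n \<in> A}"
    proof (rule Inf_greatest)
      fix t assume "t \<in> {enat n |n. 0 < n \<and> \<omega> n \<in> A}"
      then show "enat k \<le> t" using that by (force simp: not_less[symmetric])
    qed
  qed
  show ?thesis
  proof
    assume k: "return_time A \<omega> = enat k"
    have ex: "\<exists>n. 0 < n \<and> \<omega> n \<in> A"
    proof (rule ccontr)
      assume "\<not> ?thesis"
      then have "{enat n |n. 0 < n \<and> \<omega> n \<in> A} = {}" by auto
      with k show False unfolding return_time_def by (simp add: Inf_enat_def)
    qed
    define l where "l = (LEAST n. 0 < n \<and> \<omega> n \<in> A)"
    have "?first l"
      using LeastI_ex[OF ex] not_less_Least[of _ "\<lambda>n. 0 < n \<and> \<omega> n \<in> A"]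
      unfolding l_def by blast
    moreover from first[OF this] k have "l = k" by simp
    ultimately show "?first k" by simp
  qed (rule first)
qed

text \<open>The return event is split by the value of the return time, and countable additivity
  turns the pieces into a series.\<close>

lemma return_prob_sums:
  assumes S: "finite S" and p: "stochastic S p" and x: "x \<in> S" and A: "A \<subseteq> S" "z \<in> A"
  shows "(\<lambda>n. first_hit p (S - A) z n x) sums return_prob S p x A z"
proof -
  define M where "M = path_measure S p x"
  have M: "is_path_measure S p x M"
    unfolding M_def by (rule is_path_measure_path_measure[OF S p x])
  interpret prob_space M using M by (simp add: is_path_measure_def)
  note [measurable] = path_measure_pred[OF M]
  have sp: "\<omega> i \<in> S" if "\<omega> \<in> space M" for \<omega> i
    using that path_measure_space[OF M] by auto
  \<comment> \<open>The index \<open>n\<close> belongs to the return time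
    \<open>n + 1\<close>.\<close>
  define C where "C n = {\<omega> \<in> space M. (\<forall>j. 0 < j \<and> j \<le> n \<longrightarrow> \<omega> j \<in> S - A) \<and> \<omega> (Suc n) = z}" for n
  have C_sets: "C n \<in> sets M" for n unfolding C_def by measurable
  have "{\<omega> \<in> space M. \<exists>n. return_time A \<omega> = enat n \<and> \<omega> n = z} = (\<Union>n. C n)"
  proof (intro set_eqI iffI)
    fix \<omega> assume "\<omega> \<in> {\<omega> \<in> space M. \<exists>n. return_time A \<omega> = enat n \<and> \<omega> n = z}"
    then obtain k where k: "\<omega> \<in> space M" "0 < k" "\<forall>j. 0 < j \<and> j < k \<longrightarrow> \<omega> j \<notin> A" "\<omega> k = z"
      by (auto simp: return_time_eq_enat_iff)
    then obtain n where "k = Suc n" by (cases k) auto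
    with k have "\<omega> \<in> C n" by (auto simp: C_def sp)
    then show "\<omega> \<in> (\<Union>n. C n)" by blast
  next
    fix \<omega> assume "\<omega> \<in> (\<Union>n. C n)"
    then obtain n where n: "\<omega> \<in> C n" by blast
    then have "return_time A \<omega> = enat (Suc n)"
      unfolding return_time_eq_enat_iff using A by (auto simp: C_def)
    then show "\<omega> \<in> {\<omega> \<in> space M. \<exists>n. return_time A \<omega> = enat n \<and> \<omega> n = z}"
      using n by (auto simp: C_def)
  qed
  then have r: "return_prob S p x A z = measure M (\<Union>n. C n)"
    by (simp add: return_prob_def M_def)
  have "disjoint_family C"
    unfolding disjoint_family_on_def
  proof (intro ballI impI)
    fix m n :: nat assume "m \<noteq> n"
    then show "C m \<inter> C n = {}"
      \<comment> \<open>At the time after the smaller index, one event puts the path in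
        \<open>z\<close>, a point of \<open>A\<close>, and the other keeps it outside
        \<open>A\<close>.\<close>
      using A by (cases m n rule: linorder_cases) (auto simp: C_def Suc_le_eq)
  qed
  then have "(\<lambda>n. measure M (C n)) sums measure M (\<Union>n. C n)"
    using C_sets by (intro finite_measure_UNION) auto
  moreover have "measure M (C n) = first_hit p (S - A) z n x" for n
  proof -
    \<comment> \<open>\<open>?C\<close> adds the starting state to \<open>C n\<close>, which matches
      a prefix consisting of time 0 alone. The condition holds almost surely, so both events have
      the same probability.\<close>
    let ?C = "{\<omega> \<in> space M. (\<forall>i\<le>0. \<omega> i = x) \<and> (\<forall>j. 0 < j \<and> j \<le> 0 + n \<longrightarrow> \<omega> j \<in> S - A) \<and>
      \<omega> (Suc (0 + n)) = z}"
    have "prob {\<omega> \<in> space M. \<forall>i\<le>0. \<omega> i = x} = 1"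
      using path_measure_cylinder[OF M, of 0 "\<lambda>_. x"] x by simp
    then have start: "AE \<omega> in M. \<omega> \<in> {\<omega> \<in> space M. \<forall>i\<le>0. \<omega> i = x}"
      by (rule AE_prob_1)
    have "measure M (C n) = measure M ?C"
    proof (rule finite_measure_eq_AE)
      show "AE \<omega> in M. \<omega> \<in> C n \<longleftrightarrow> \<omega> \<in> ?C"
        using start by eventually_elim (auto simp: C_def)
      show "?C \<in> sets M" by measurable
    qed (rule C_sets)
    also have "\<dots> = first_hit p (S - A) z n x"
      using path_measure_first_hit[OF S, of "S - A" z p x M 0 "\<lambda>_. x" n] M x A by auto
    finally show ?thesis .
  qed
  ultimately show ?thesis by (simp add: r)
qed

text \<open>Splitting off the term of index 0 from the series leaves the shifted one, which the
  recursion of \<open>first_hit\<close> evaluates as a finite combination of the series started at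
  the states \<open>v\<close>.\<close>

lemma return_prob_first_step:
  assumes S: "finite S" and p: "stochastic S p" and x: "x \<in> S" and A: "A \<subseteq> S" "z \<in> A"
  shows "return_prob S p x A z = p x z + (\<Sum>v\<in>S - A. p x v * return_prob S p v A z)"
proof -
  note sums = return_prob_sums[OF S p _ A]
  have "(\<lambda>n. first_hit p (S - A) z (Suc n) x) sums (return_prob S p x A z - p x z)"
    by (rule sums_Suc_iff[THEN iffD2]) (use sums[OF x] in simp)
  moreover have "(\<lambda>n. first_hit p (S - A) z (Suc n) x) sums
      (\<Sum>v\<in>S - A. p x v * return_prob S p v A z)"
    unfolding first_hit.simps(2) by (intro sums_sum sums_mult sums) auto
  ultimately show ?thesis using sums_unique2 by fastforce
qed

section \<open>The chains on the representatives\<close>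

text \<open>Loops do not affect reachability, so only off-diagonal entries are compared. This fits
  the passage to both matrices of the theorem, which rescale off-diagonal entries and adjust the
  diagonal.\<close>

lemma irreducible_chain_mono:
  assumes irr: "irreducible_chain A p"
    and pos: "\<And>a b. a \<in> A \<Longrightarrow> b \<in> A \<Longrightarrow> a \<noteq> b \<Longrightarrow> 0 < p a b \<Longrightarrow> 0 < q a b"
  shows "irreducible_chain A q"
proof -
  have "(a, b) \<in> (step_rel A q)\<^sup>*" if "(a, b) \<in> step_rel A p" for a b
    using that pos[of a b] by (cases "a = b") (auto simp: step_rel_def)
  then have "step_rel A p \<subseteq> (step_rel A q)\<^sup>*" by auto
  then have "(step_rel A p)\<^sup>* \<subseteq> (step_rel A q)\<^sup>*" by (rule rtrancl_subset_rtrancl)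
  then show ?thesis using irr by (auto simp: irreducible_chain_def)
qed

section \<open>Essential classes and their stationary distributions\<close>

lemma equiv_communicates: "equiv S (communicates S p)"
  by (rule equivI) (auto simp: communicates_def refl_on_def sym_def trans_def intro: rtrancl_trans)

lemma essential_class_subset: "E \<in> essential_classes S p \<Longrightarrow> E \<subseteq> S"
  unfolding essential_classes_def using in_quotient_imp_subset[OF equiv_communicates] by blast

lemma essential_classes_disjoint:
  "E \<in> essential_classes S p \<Longrightarrow> F \<in> essential_classes S p \<Longrightarrow> x \<in> E \<Longrightarrow> x \<in> F \<Longrightarrow> E = F"
  unfolding essential_classes_def using quotient_disj[OF equiv_communicates] by blast

text \<open>Stationarity bounds \<open>\<nu> b\<close> below by \<open>\<nu> a * p a b\<close>, so
  positivity spreads along arrows. Total mass 1 supplies a point of positive mass, from which every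
  point of the class is reachable.\<close>

lemma stationary_distribution_pos:
  assumes S: "finite S" and p: "stochastic S p" and E: "E \<in> essential_classes S p"
    and \<nu>: "stationary_distribution E p \<nu>" and x: "x \<in> E"
  shows "0 < \<nu> x"
proof -
  have ES: "E \<subseteq> S" by (rule essential_class_subset[OF E])
  then have finE: "finite E" using S finite_subset by blast
  have nn: "0 \<le> \<nu> a" if "a \<in> E" for a using \<nu> that by (simp add: stationary_distribution_def)
  have "\<exists>y\<in>E. \<nu> y \<noteq> 0"
  proof (rule ccontr)
    assume "\<not> ?thesis"
    then have "(\<Sum>y\<in>E. \<nu> y) = 0" by simp
    then show False using \<nu> by (simp add: stationary_distribution_def)
  qed
  then obtain y where y: "y \<in> E" "0 < \<nu> y" using nn by force
  have "(y, x) \<in> communicates S p"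
    using in_quotient_imp_in_rel[OF equiv_communicates, of E S p y x] E x y
    by (simp add: essential_classes_def)
  then have "(y, x) \<in> (step_rel S p)\<^sup>*" by (simp add: communicates_def)
  then have "x \<in> E \<and> 0 < \<nu> x"
  proof (induction rule: rtrancl_induct)
    case base
    then show ?case using y by simp
  next
    case (step a b)
    \<comment> \<open>Closedness of the class keeps the path inside \<open>E\<close>, where
      stationarity is available.\<close>
    then have b: "b \<in> E" using E unfolding essential_classes_def by blast
    have "0 < \<nu> a * p a b" using step by (simp add: step_rel_def)
    also have "\<dots> \<le> (\<Sum>c\<in>E. \<nu> c * p c b)"
    proof (rule member_le_sum)
      show "0 \<le> \<nu> c * p c b" if "c \<in> E - {a}" for c
        using that b ES nn p by (intro mult_nonneg_nonneg) (auto simp: stochastic_def)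
    qed (use step finE in auto)
    also have "\<dots> = \<nu> b" using \<nu> b by (simp add: stationary_distribution_def)
    finally show ?case using b by simp
  qed
  then show ?thesis by simp
qed

lemma stationary_distribution_le_1:
  assumes "finite E" "stationary_distribution E p \<nu>" "x \<in> E"
  shows "\<nu> x \<le> 1"
proof -
  have "\<nu> x \<le> (\<Sum>a\<in>E. \<nu> a)"
    using assms by (intro member_le_sum) (auto simp: stationary_distribution_def)
  then show ?thesis using assms by (simp add: stationary_distribution_def)
qed

section \<open>Return chains, lazy chains and normalized chains\<close>

context regular_chain
begin

lemma tame_chain_self: "tame_chain S P"
  using regular tame_entry
  unfolding tame_chain_def regular_perturbed_chain_def irreducibly_perturbed_chain_def
    perturbed_chain_def
  by simp

text \<open>Stochasticity of the return probabilities, that is, almost sure return to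
  \<open>A\<close>, comes out of the elimination and takes no separate argument.\<close>

lemma tame_chain_return_prob:
  assumes S: "finite S" and A: "A \<subseteq> S" "A \<noteq> {}"
  shows "tame_chain A (\<lambda>\<epsilon> a b. return_prob S (P \<epsilon>) a A b)"
proof (rule tame_chain_hitting[of "S - A" A P])
  have SA: "S - A \<union> A = S" using A by blast
  show "tame_chain (S - A \<union> A) P" unfolding SA by (rule tame_chain_self)
  fix \<epsilon> x y assume "0 < (\<epsilon>::real)" "x \<in> S - A \<union> A" "y \<in> A"
  then show "return_prob S (P \<epsilon>) x A y =
      P \<epsilon> x y + (\<Sum>u\<in>S - A. P \<epsilon> x u * return_prob S (P \<epsilon>) u A y)"
    using tame_chain_self S A unfolding SA
    by (intro return_prob_first_step) (auto simp: tame_chain_def)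
qed (use assms in \<open>auto intro: finite_subset\<close>)

text \<open>Row by row, \<open>Q\<close> is the convex combination of \<open>R\<close> and the
  identity with weight \<open>w a\<close>. A positive weight preserves irreducibility, and a weight
  of at most 1 keeps the added diagonal term nonnegative and hence tame.\<close>

lemma tame_chain_lazy:
  assumes A: "finite A" and R: "tame_chain A R"
    and w: "\<And>a. a \<in> A \<Longrightarrow> 0 < w a" "\<And>a. a \<in> A \<Longrightarrow> w a \<le> 1"
    and offdiag: "\<And>\<epsilon> a b. 0 < \<epsilon> \<Longrightarrow> a \<in> A \<Longrightarrow> b \<in> A \<Longrightarrow> a \<noteq> b \<Longrightarrow> Q \<epsilon> a b = w a * R \<epsilon> a b"
    and diag: "\<And>\<epsilon> a. 0 < \<epsilon> \<Longrightarrow> a \<in> A \<Longrightarrow> Q \<epsilon> a a = w a * R \<epsilon> a a + 1 - w a"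
  shows "tame_chain A Q"
  unfolding tame_chain_def
proof (intro conjI allI impI ballI)
  have R': "stochastic A (R \<epsilon>)" "irreducible_chain A (R \<epsilon>)" if "0 < \<epsilon>" for \<epsilon>
    using R that by (simp_all add: tame_chain_def)
  have eq: "Q \<epsilon> a b = w a * R \<epsilon> a b + (if a = b then 1 - w a else 0)"
    if "0 < \<epsilon>" "a \<in> A" "b \<in> A" for \<epsilon> a b
    using offdiag[OF that] diag[OF that(1,2)] by (cases "a = b") simp_all
  fix \<epsilon> :: real assume e: "0 < \<epsilon>"
  show "stochastic A (Q \<epsilon>)"
    unfolding stochastic_def
  proof (intro ballI conjI)
    fix a assume a: "a \<in> A"
    show "0 \<le> Q \<epsilon> a b" if "b \<in> A" for b
      unfolding eq[OF e a that] using R'(1)[OF e] w[OF a] a that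
      by (intro add_nonneg_nonneg mult_nonneg_nonneg) (auto simp: stochastic_def)
    have "(\<Sum>b\<in>A. Q \<epsilon> a b) = (\<Sum>b\<in>A. w a * R \<epsilon> a b + (if a = b then 1 - w a else 0))"
      using eq[OF e a] by simp
    also have "\<dots> = w a * (\<Sum>b\<in>A. R \<epsilon> a b) + (1 - w a)"
      using A a by (simp add: sum.distrib sum_distrib_left)
    finally show "(\<Sum>b\<in>A. Q \<epsilon> a b) = 1"
      using R'(1)[OF e] a by (simp add: stochastic_def)
  qed
  show "irreducible_chain A (Q \<epsilon>)"
    by (rule irreducible_chain_mono[OF R'(2)[OF e]]) (simp add: offdiag e w)
next
  fix a b assume ab: "a \<in> A" "b \<in> A"
  have "tame (\<lambda>\<epsilon>. w a * R \<epsilon> a b + (if a = b then 1 - w a else 0))"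
    using R w[OF ab(1)] ab by (intro tame_add tame_mult tame_const) (auto simp: tame_chain_def)
  then show "tame (\<lambda>\<epsilon>. Q \<epsilon> a b)"
    by (rule tame_cong) (use offdiag diag ab in auto)
qed

text \<open>The diagonal is defined by a subtraction, under which tame functions are not closed. It
  is rewritten as the exit mass of all other states divided by the total exit mass, a quotient of
  sums of tame functions.\<close>

lemma tame_chain_normalized:
  assumes A: "finite A" and Q: "tame_chain A Q"
    and offdiag: "\<And>\<epsilon> a b. 0 < \<epsilon> \<Longrightarrow> a \<in> A \<Longrightarrow> b \<in> A \<Longrightarrow> a \<noteq> b \<Longrightarrow>
      R \<epsilon> a b = Q \<epsilon> a b / (\<Sum>k\<in>A. \<Sum>l\<in>A - {k}. Q \<epsilon> k l)"
    and diag: "\<And>\<epsilon> a. 0 < \<epsilon> \<Longrightarrow> a \<in> A \<Longrightarrow> R \<epsilon> a a = 1 - (\<Sum>b\<in>A - {a}. R \<epsilon> a b)"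
  shows "tame_chain A R"
proof (cases "\<exists>a\<in>A. \<exists>b\<in>A. a \<noteq> b")
  \<comment> \<open>With at most one state there are no off-diagonal entries and the normalizing sum
    is zero; a single state simply gets the entry 1.\<close>
  case False
  then consider "A = {}" | a where "A = {a}" by blast
  then show ?thesis
  proof cases
    case 1
    then show ?thesis by (simp add: tame_chain_def stochastic_def irreducible_chain_def)
  next
    case (2 a)
    then have one: "R \<epsilon> a a = 1" if "0 < \<epsilon>" for \<epsilon> using diag[OF that, of a] by simp
    have "tame (\<lambda>\<epsilon>. R \<epsilon> a a)" by (rule tame_cong[OF tame_const[of 1]]) (simp_all add: one)
    then show ?thesis
      using 2 one by (simp add: tame_chain_def stochastic_def irreducible_chain_def)
  qed
next
  case True
  have Q': "stochastic A (Q \<epsilon>)" "irreducible_chain A (Q \<epsilon>)" if "0 < \<epsilon>" for \<epsilon>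
    using Q that by (simp_all add: tame_chain_def)
  \<comment> \<open>\<open>s \<epsilon> k\<close> is the exit mass of \<open>k\<close>, and
    \<open>t \<epsilon>\<close> below is the normalizing total.\<close>
  define s where "s \<epsilon> k = (\<Sum>l\<in>A - {k}. Q \<epsilon> k l)" for \<epsilon> k
  define t where "t \<epsilon> = (\<Sum>k\<in>A. s \<epsilon> k)" for \<epsilon>
  have s_pos: "0 < s \<epsilon> k" if "0 < \<epsilon>" "k \<in> A" for \<epsilon> k
  proof -
    obtain a where "a \<in> A" "a \<noteq> k" using True by metis
    then show ?thesis
      unfolding s_def by (rule irreducible_exit_pos[OF A that(2) _ _ Q'[OF that(1)]])
  qed
  have t_pos: "0 < t \<epsilon>" if "0 < \<epsilon>" for \<epsilon>
    unfolding t_def using True s_pos[OF that] A by (intro sum_pos) auto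
  have off: "R \<epsilon> a b = Q \<epsilon> a b / t \<epsilon>" if "0 < \<epsilon>" "a \<in> A" "b \<in> A" "a \<noteq> b" for \<epsilon> a b
    using offdiag[OF that] by (simp add: t_def s_def)
  have off_sum: "(\<Sum>b\<in>A - {a}. R \<epsilon> a b) = s \<epsilon> a / t \<epsilon>" if "0 < \<epsilon>" "a \<in> A" for \<epsilon> a
    unfolding s_def sum_divide_distrib by (rule sum.cong) (use off[OF that] in auto)
  \<comment> \<open>Subtracting the share \<open>s \<epsilon> a / t \<epsilon>\<close> from 1 leaves
    the shares of the other states: this is the form without subtraction.\<close>
  have dg: "R \<epsilon> a a = (\<Sum>k\<in>A - {a}. s \<epsilon> k) / t \<epsilon>" if "0 < \<epsilon>" "a \<in> A" for \<epsilon> a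
  proof -
    have "t \<epsilon> = s \<epsilon> a + (\<Sum>k\<in>A - {a}. s \<epsilon> k)"
      unfolding t_def using A that by (intro sum.remove)
    then show ?thesis
      using diag[OF that] off_sum[OF that] t_pos[OF that(1)] by (simp add: field_simps)
  qed
  have s_tame: "tame (\<lambda>\<epsilon>. s \<epsilon> k)" if "k \<in> A" for k
    unfolding s_def using Q A that by (intro tame_sum) (auto simp: tame_chain_def)
  have t_tame: "tame t"
    unfolding t_def[abs_def] using A s_tame by (intro tame_sum)
  show ?thesis
    unfolding tame_chain_def
  proof (intro conjI allI impI ballI)
    fix \<epsilon> :: real assume e: "0 < \<epsilon>"
    show "stochastic A (R \<epsilon>)"
      unfolding stochastic_def
    proof (intro ballI conjI)
      fix a assume a: "a \<in> A"
      show "0 \<le> R \<epsilon> a b" if "b \<in> A" for b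
      proof (cases "a = b")
        case True
        have "0 \<le> (\<Sum>k\<in>A - {a}. s \<epsilon> k)"
          using s_pos[OF e] by (intro sum_nonneg) (auto intro: less_imp_le)
        then show ?thesis
          using True dg[OF e a] t_pos[OF e] by simp
      next
        case False
        then show ?thesis
          using off[OF e a that] Q'(1)[OF e] a that t_pos[OF e] by (simp add: stochastic_def)
      qed
      show "(\<Sum>b\<in>A. R \<epsilon> a b) = 1"
        using diag[OF e a] A a by (simp add: sum.remove[of A a])
    qed
    show "irreducible_chain A (R \<epsilon>)"
      by (rule irreducible_chain_mono[OF Q'(2)[OF e]]) (simp add: off e t_pos)
  next
    fix a b assume ab: "a \<in> A" "b \<in> A"
    show "tame (\<lambda>\<epsilon>. R \<epsilon> a b)"
    proof (cases "a = b")
      case True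
      have "tame (\<lambda>\<epsilon>. (\<Sum>k\<in>A - {a}. s \<epsilon> k) / t \<epsilon>)"
        using A s_tame t_tame by (intro tame_divide tame_sum) auto
      then show ?thesis by (rule tame_cong) (use True dg ab in auto)
    next
      case False
      have "tame (\<lambda>\<epsilon>. Q \<epsilon> a b / t \<epsilon>)"
        using Q t_tame ab by (intro tame_divide) (auto simp: tame_chain_def)
      then show ?thesis by (rule tame_cong) (use False off ab in auto)
    qed
  qed
qed

end

section \<open>From indexed representatives to chains on a set of states\<close>

theorem theorem4p4:
  fixes S :: "'a set" and P :: "real \<Rightarrow> 'a \<Rightarrow> 'a \<Rightarrow> real"
    and n :: nat and E :: "nat \<Rightarrow> 'a set" and x :: "nat \<Rightarrow> 'a" and S0 :: "'a set"
    and \<nu> :: "nat \<Rightarrow> 'a \<Rightarrow> real"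
    and Phat Pcheck :: "real \<Rightarrow> 'a \<Rightarrow> 'a \<Rightarrow> real"
  assumes finite_S: "finite S"
    and regular: "regular_perturbed_chain S P"
    and classes: "bij_betw E {1..n} (essential_classes S (P 0))"
    and representatives: "\<And>i. i \<in> {1..n} \<Longrightarrow> x i \<in> E i"
    and stationary: "\<And>i. i \<in> {1..n} \<Longrightarrow> stationary_distribution (E i) (P 0) (\<nu> i)"
    and S0_def: "S0 = x ` {1..n}"
    and Phat_offdiag: "\<And>\<epsilon> i j. \<epsilon> > 0 \<Longrightarrow> i \<in> {1..n} \<Longrightarrow> j \<in> {1..n} \<Longrightarrow> i \<noteq> j \<Longrightarrow>
        Phat \<epsilon> (x i) (x j) = \<nu> i (x i) * return_prob S (P \<epsilon>) (x i) S0 (x j)"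
    and Phat_diag: "\<And>\<epsilon> i. \<epsilon> > 0 \<Longrightarrow> i \<in> {1..n} \<Longrightarrow>
        Phat \<epsilon> (x i) (x i) =
          \<nu> i (x i) * return_prob S (P \<epsilon>) (x i) S0 (x i) + 1 - \<nu> i (x i)"
    and Pcheck_offdiag: "\<And>\<epsilon> i j. \<epsilon> > 0 \<Longrightarrow> i \<in> {1..n} \<Longrightarrow> j \<in> {1..n} \<Longrightarrow> i \<noteq> j \<Longrightarrow>
        Pcheck \<epsilon> (x i) (x j) =
          Phat \<epsilon> (x i) (x j) / (\<Sum>k\<in>{1..n}. \<Sum>l\<in>{1..n} - {k}. Phat \<epsilon> (x k) (x l))"
    and Pcheck_diag: "\<And>\<epsilon> i. \<epsilon> > 0 \<Longrightarrow> i \<in> {1..n} \<Longrightarrow>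
        Pcheck \<epsilon> (x i) (x i) = 1 - (\<Sum>j\<in>{1..n} - {i}. Pcheck \<epsilon> (x i) (x j))"
  shows "regular_perturbed_family S0 Phat \<and> regular_perturbed_family S0 Pcheck"
proof (cases "n = 0")
  \<comment> \<open>Here \<open>S0\<close> is empty and every claim is vacuous. Setting this case
    aside makes \<open>S0\<close> nonempty below, as the elimination of the other states
    requires.\<close>
  case True
  interpret regular_chain S P by unfold_locales (rule regular)
  have "tame_chain S0 Q" for Q
    using True by (simp add: S0_def tame_chain_def stochastic_def irreducible_chain_def)
  then show ?thesis
    using True tame_chain_regular_perturbed_family[of S0] by (simp add: S0_def)
next
  case False
  interpret regular_chain S P by unfold_locales (rule regular)
  have P0: "stochastic S (P 0)"
    using regular by (simp add: regular_perturbed_chain_def irreducibly_perturbed_chain_def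
        perturbed_chain_def)
  have E: "E i \<in> essential_classes S (P 0)" if "i \<in> {1..n}" for i
    using classes that by (auto simp: bij_betw_def)
  \<comment> \<open>Distinct essential classes are disjoint, so indices and representatives
    correspond one to one, and double sums over indices become double sums over states.\<close>
  have inj: "inj_on x {1..n}"
  proof (rule inj_onI)
    fix i j assume ij: "i \<in> {1..n}" "j \<in> {1..n}" "x i = x j"
    then have "E i = E j"
      using essential_classes_disjoint[OF E E] representatives by metis
    then show "i = j" using classes ij by (auto simp: bij_betw_def dest: inj_onD)
  qed
  have S0: "finite S0" "S0 \<subseteq> S" "S0 \<noteq> {}"
    using False representatives subsetD[OF essential_class_subset[OF E]] by (auto simp: S0_def)
  \<comment> \<open>The index-dependent number \<open>\<nu> i (x i)\<close> becomes a weight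
    attached to the state \<open>x i\<close>, in the form that \<open>tame_chain_lazy\<close>
    takes.\<close>
  define w where "w a = \<nu> (inv_into {1..n} x a) a" for a
  have w: "w (x i) = \<nu> i (x i)" if "i \<in> {1..n}" for i
    using inj that by (simp add: w_def)
  have w_pos: "0 < w a" and w_le: "w a \<le> 1" if "a \<in> S0" for a
  proof -
    from that obtain i where i: "i \<in> {1..n}" "a = x i" by (auto simp: S0_def)
    show "0 < w a"
      unfolding i w[OF i(1)]
      by (rule stationary_distribution_pos[OF finite_S P0 E[OF i(1)] stationary[OF i(1)]
            representatives[OF i(1)]])
    show "w a \<le> 1"
      unfolding i w[OF i(1)]
      by (rule stationary_distribution_le_1[OF _ stationary[OF i(1)] representatives[OF i(1)]])
        (use essential_class_subset[OF E[OF i(1)]] finite_S finite_subset in blast)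
  qed
  have remove: "S0 - {x k} = x ` ({1..n} - {k})" if "k \<in> {1..n}" for k
    using inj_on_image_set_diff[OF inj, of "{1..n}" "{k}"] that by (simp add: S0_def)
  have sum_remove: "(\<Sum>l\<in>S0 - {x k}. f l) = (\<Sum>l\<in>{1..n} - {k}. f (x l))" if "k \<in> {1..n}"
    for f :: "'a \<Rightarrow> real" and k
    unfolding remove[OF that] by (subst sum.reindex) (use inj in \<open>auto intro: inj_on_subset\<close>)
  have sum_S0: "(\<Sum>k\<in>S0. f k) = (\<Sum>k\<in>{1..n}. f (x k))" for f :: "'a \<Rightarrow> real"
    unfolding S0_def by (subst sum.reindex) (use inj in auto)
  have hat: "tame_chain S0 Phat"
  proof (rule tame_chain_lazy[OF S0(1) tame_chain_return_prob[OF finite_S S0(2,3)] w_pos w_le])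
    fix \<epsilon> :: real and a b assume e: "0 < \<epsilon>" and ab: "a \<in> S0" "b \<in> S0" "a \<noteq> b"
    then obtain i j where ij: "i \<in> {1..n}" "j \<in> {1..n}" "a = x i" "b = x j" "i \<noteq> j"
      unfolding S0_def by blast
    show "Phat \<epsilon> a b = w a * return_prob S (P \<epsilon>) a S0 b"
      unfolding ij(3,4) w[OF ij(1)] by (rule Phat_offdiag[OF e ij(1,2,5)])
  next
    fix \<epsilon> :: real and a assume e: "0 < \<epsilon>" and a: "a \<in> S0"
    then obtain i where i: "i \<in> {1..n}" "a = x i" by (auto simp: S0_def)
    show "Phat \<epsilon> a a = w a * return_prob S (P \<epsilon>) a S0 a + 1 - w a"
      unfolding i(2) w[OF i(1)] by (rule Phat_diag[OF e i(1)])
  qed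
  have check: "tame_chain S0 Pcheck"
  proof (rule tame_chain_normalized[OF S0(1) hat])
    fix \<epsilon> :: real and a b assume e: "0 < \<epsilon>" and ab: "a \<in> S0" "b \<in> S0" "a \<noteq> b"
    then obtain i j where ij: "i \<in> {1..n}" "j \<in> {1..n}" "a = x i" "b = x j" "i \<noteq> j"
      unfolding S0_def by blast
    have "(\<Sum>k\<in>S0. \<Sum>l\<in>S0 - {k}. Phat \<epsilon> k l) =
        (\<Sum>k\<in>{1..n}. \<Sum>l\<in>{1..n} - {k}. Phat \<epsilon> (x k) (x l))"
      unfolding sum_S0 by (intro sum.cong refl sum_remove)
    then show "Pcheck \<epsilon> a b = Phat \<epsilon> a b / (\<Sum>k\<in>S0. \<Sum>l\<in>S0 - {k}. Phat \<epsilon> k l)"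
      using Pcheck_offdiag[OF e ij(1,2,5)] ij by simp
  next
    fix \<epsilon> :: real and a assume e: "0 < \<epsilon>" and a: "a \<in> S0"
    then obtain i where i: "i \<in> {1..n}" "a = x i" by (auto simp: S0_def)
    show "Pcheck \<epsilon> a a = 1 - (\<Sum>b\<in>S0 - {a}. Pcheck \<epsilon> a b)"
      unfolding i(2) sum_remove[OF i(1)] by (rule Pcheck_diag[OF e i(1)])
  qed
  show ?thesis
    using tame_chain_regular_perturbed_family[OF S0(1)] hat check by blast
qed

end
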